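(* Let $F$ be an algebraically closed field of characteristic $0$, let $m\geqslant 2$, and let $\zeta\in F$ be a primitive $m$th root of unity. Let $L$ be a finite dimensional $H_{m^2}(\zeta)$-simple $H_{m^2}(\zeta)$-module Lie algebra over $F$ which, as an ordinary Lie algebra, is semisimple but not simple. Then $L$ is a $\mathbb Z_m$-graded simple Lie algebra (with respect to the grading induced by the $c$-action). If moreover $vL\ne 0$, then $L\cong L_\alpha(B)$ as $H_{m^2}(\zeta)$-module Lie algebras for some simple Lie algebra $B$ over $F$ and some $\alpha\in F$.
   Context: Let $m\geqslant 2$ and let $F$ be a field containing a primitive $m$th root of unity $\zeta$. The Taft algebra $H_{m^2}(\zeta)$ is the unital associative $F$-algebra generated by $c,v$ with relations $c^m=1$, $v^m=0$, $vc=\zeta cv$; it is a Hopf algebra with $\Delta(c)=c\otimes c$, $\Delta(v)=c\otimes v+v\otimes 1$, $\varepsilon(c)=1$, $\varepsilon(v)=0$, $S(c)=c^{-1}$, $S(v)=-c^{-1}v$. An $H_{m^2}(\zeta)$-module Lie algebra is a Lie algebra $L$ over $F$ that is a left $H_{m^2}(\zeta)$-module with $h[a,b]=[h_{(1)}a,h_{(2)}b]$ for all $h$ and all $a,b\in L$; in particular $c$ acts by a Lie automorphism and $v[a,b]=[ca,vb]+[va,b]$. Isomorphisms of $H_{m^2}(\zeta)$-module Lie algebras are Lie algebra isomorphisms that are also $H_{m^2}(\zeta)$-module maps. $L$ is $H_{m^2}(\zeta)$-simple if $[L,L]\neq 0$ and $L$ has no $H_{m^2}(\zeta)$-invariant ideals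 other than $0$ and $L$. The $c$-action induces the $\mathbb Z_m$-grading $L=\bigoplus_{i=0}^{m-1}L^{(i)}$, $L^{(i)}=\{a\in L\mid ca=\zeta^i a\}$. $L$ is $\mathbb Z_m$-graded simple if $[L,L]\ne 0$ and $L$ has no ideals homogeneous in this grading other than $0$ and $L$. For a simple Lie algebra $B$ over $F$ and $\alpha\in F$, $L_\alpha(B):=B\oplus\dots\oplus B$ ($m$ copies, direct sum of ideals) with the $H_{m^2}(\zeta)$-action $$c(a_1,a_2,\ldots,a_m)=(a_m,a_1,a_2,\ldots,a_{m-1}),$$ $$v(a_1,\ldots,a_m)=\alpha\left(a_1-a_m,\ \zeta(a_2-a_1),\ \ldots,\ \zeta^{m-1}(a_m-a_{m-1})\right).$$ *)

theory Defs
  imports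
    "HOL-Algebra.QuotRing"
    "HOL-Computational_Algebra.Polynomial"
    "HOL-Library.Poly_Mapping"
    "HOL-Library.Product_Plus"
    "HOL-Library.Function_Algebras"
begin

section \<open>Lie algebras\<close>

text \<open>
  A Lie algebra is carried by a subspace \<open>L\<close> of an ambient vector space, so that ideals,
  direct sums of copies, and existentially quantified Lie algebras are all instances of one notion.
\<close>

locale lie_algebra = vector_space scale
  for scale :: "'f::field \<Rightarrow> 'v::ab_group_add \<Rightarrow> 'v" +
  fixes L :: "'v set"
    and br :: "'v \<Rightarrow> 'v \<Rightarrow> 'v"
  assumes subspace_carrier: "subspace L"
    and br_closed: "\<And>x y. x \<in> L \<Longrightarrow> y \<in> L \<Longrightarrow> br x y \<in> L"
    and br_add_left: "\<And>x y z. x \<in> L \<Longrightarrow> y \<in> L \<Longrightarrow> z \<in> L \<Longrightarrow> br (x + y) z = br x z + br y z"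
    and br_add_right: "\<And>x y z. x \<in> L \<Longrightarrow> y \<in> L \<Longrightarrow> z \<in> L \<Longrightarrow> br x (y + z) = br x y + br x z"
    and br_scale_left: "\<And>r x y. x \<in> L \<Longrightarrow> y \<in> L \<Longrightarrow> br (scale r x) y = scale r (br x y)"
    and br_scale_right: "\<And>r x y. x \<in> L \<Longrightarrow> y \<in> L \<Longrightarrow> br x (scale r y) = scale r (br x y)"
    and br_self: "\<And>x. x \<in> L \<Longrightarrow> br x x = 0"
    and jacobi: "\<And>x y z. x \<in> L \<Longrightarrow> y \<in> L \<Longrightarrow> z \<in> L \<Longrightarrow>
      br x (br y z) + br y (br z x) + br z (br x y) = 0"
begin

definition fin_dim :: bool
  where "fin_dim \<longleftrightarrow> (\<exists>S. finite S \<and> span S = L)"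

definition lie_ideal :: "'v set \<Rightarrow> bool"
  where "lie_ideal I \<longleftrightarrow> subspace I \<and> I \<subseteq> L \<and> (\<forall>x\<in>L. \<forall>y\<in>I. br x y \<in> I)"

definition commutator :: "'v set \<Rightarrow> 'v set \<Rightarrow> 'v set"
  where "commutator A B = span {br x y |x y. x \<in> A \<and> y \<in> B}"

primrec derived_series :: "'v set \<Rightarrow> nat \<Rightarrow> 'v set"
  where
    "derived_series I 0 = I"
  | "derived_series I (Suc n) = commutator (derived_series I n) (derived_series I n)"

definition solvable :: "'v set \<Rightarrow> bool"
  where "solvable I \<longleftrightarrow> (\<exists>n. derived_series I n = {0})"

text \<open>Semisimplicity means that the solvable radical vanishes.\<close>

definition semisimple :: bool
  where "semisimple \<longleftrightarrow> (\<forall>I. lie_ideal I \<and> solvable I \<longrightarrow> I = {0})"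

definition simple :: bool
  where "simple \<longleftrightarrow>
    commutator L L \<noteq> {0} \<and> (\<forall>I. lie_ideal I \<longrightarrow> I = {0} \<or> I = L)"

end


section \<open>The Taft algebra\<close>

datatype taft_gen = Gen_c | Gen_v

text \<open>The free monoid on the two generators, written additively as \<^typ>\<open>'a \<Rightarrow>\<^sub>0 'b\<close> requires.\<close>

datatype taft_word = Word (letters: "taft_gen list")

instantiation taft_word :: monoid_add
begin

definition zero_taft_word :: taft_word
  where "0 = Word []"

definition plus_taft_word :: "taft_word \<Rightarrow> taft_word \<Rightarrow> taft_word"
  where "u + w = Word (letters u @ letters w)"

instance
  by standard (simp_all add: zero_taft_word_def plus_taft_word_def)

end

text \<open>
  The convolution product makes \<open>taft_word \<Rightarrow>\<^sub>0 'f\<close> the free algebra \<open>F\<langle>c, v\<rangle>\<close>, and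
  \<open>taft_word \<times> taft_word \<Rightarrow>\<^sub>0 'f\<close> the tensor product \<open>F\<langle>c, v\<rangle> \<otimes> F\<langle>c, v\<rangle>\<close>, where the
  pair \<open>(u, w)\<close> stands for \<open>u \<otimes> w\<close>.
\<close>

type_synonym 'f free_alg = "taft_word \<Rightarrow>\<^sub>0 'f"

definition free_ring :: "'f::field free_alg ring"
  where "free_ring = \<lparr>carrier = UNIV, monoid.mult = (*), one = 1, zero = 0, add = (+)\<rparr>"

definition free_scalar :: "'f::field \<Rightarrow> 'f free_alg"
  where "free_scalar r = Poly_Mapping.single 0 r"

definition free_gen :: "taft_gen \<Rightarrow> 'f::field free_alg"
  where "free_gen g = Poly_Mapping.single (Word [g]) 1"

definition taft_relations :: "nat \<Rightarrow> 'f::field \<Rightarrow> 'f free_alg set"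
  where "taft_relations m \<zeta> =
    {free_gen Gen_c ^ m - 1,
     free_gen Gen_v ^ m,
     free_gen Gen_v * free_gen Gen_c - free_scalar \<zeta> * free_gen Gen_c * free_gen Gen_v}"

definition taft_ideal :: "nat \<Rightarrow> 'f::field \<Rightarrow> 'f free_alg set"
  where "taft_ideal m \<zeta> = Idl\<^bsub>free_ring\<^esub> (taft_relations m \<zeta>)"

definition taft_algebra :: "nat \<Rightarrow> 'f::field \<Rightarrow> 'f free_alg set ring"
  where "taft_algebra m \<zeta> = free_ring Quot (taft_ideal m \<zeta>)"

definition taft_class :: "nat \<Rightarrow> 'f::field \<Rightarrow> 'f free_alg \<Rightarrow> 'f free_alg set"
  where "taft_class m \<zeta> f = taft_ideal m \<zeta> +>\<^bsub>free_ring\<^esub> f"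

abbreviation taft_c :: "nat \<Rightarrow> 'f::field \<Rightarrow> 'f free_alg set"
  where "taft_c m \<zeta> \<equiv> taft_class m \<zeta> (free_gen Gen_c)"

abbreviation taft_v :: "nat \<Rightarrow> 'f::field \<Rightarrow> 'f free_alg set"
  where "taft_v m \<zeta> \<equiv> taft_class m \<zeta> (free_gen Gen_v)"

text \<open>
  The comultiplication of the Taft algebra is induced by the algebra homomorphism
  \<open>F\<langle>c, v\<rangle> \<rightarrow> F\<langle>c, v\<rangle> \<otimes> F\<langle>c, v\<rangle>\<close> with \<open>c \<mapsto> c \<otimes> c\<close> and \<open>v \<mapsto> c \<otimes> v + v \<otimes> 1\<close>.
\<close>

primrec comult_gen :: "taft_gen \<Rightarrow> (taft_word \<times> taft_word \<Rightarrow>\<^sub>0 'f::field)"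
  where
    "comult_gen Gen_c = Poly_Mapping.single (Word [Gen_c], Word [Gen_c]) 1"
  | "comult_gen Gen_v =
      Poly_Mapping.single (Word [Gen_c], Word [Gen_v]) 1 + Poly_Mapping.single (Word [Gen_v], 0) 1"

definition comult_word :: "taft_word \<Rightarrow> (taft_word \<times> taft_word \<Rightarrow>\<^sub>0 'f::field)"
  where "comult_word w = prod_list (map comult_gen (letters w))"

definition comult :: "'f::field free_alg \<Rightarrow> (taft_word \<times> taft_word \<Rightarrow>\<^sub>0 'f)"
  where "comult f =
    (\<Sum>w\<in>Poly_Mapping.keys f. Poly_Mapping.single 0 (Poly_Mapping.lookup f w) * comult_word w)"


section \<open>Module Lie algebras over the Taft algebra\<close>

definition primitive_root_of_unity :: "nat \<Rightarrow> 'f::field \<Rightarrow> bool"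
  where "primitive_root_of_unity m \<zeta> \<longleftrightarrow> \<zeta> ^ m = 1 \<and> (\<forall>k. 0 < k \<and> k < m \<longrightarrow> \<zeta> ^ k \<noteq> 1)"

text \<open>
  The axiom \<open>act_scalar\<close> says that the vector space structure is the one induced by
  \<open>F \<rightarrow> H\<close>; it makes the action unital and bilinear over \<open>F\<close>.  In \<open>act_br\<close> the element \<open>h\<close> of
  \<open>H\<close> is the class of \<open>f\<close>, and \<open>h\<^sub>(\<^sub>1\<^sub>) \<otimes> h\<^sub>(\<^sub>2\<^sub>)\<close> is the image in \<open>H \<otimes> H\<close> of
  the sum of the \<open>comult f (u, w) u \<otimes> w\<close>.
\<close>

locale taft_module_lie_algebra = lie_algebra scale L br
  for scale :: "'f::field \<Rightarrow> 'v::ab_group_add \<Rightarrow> 'v"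
    and L :: "'v set"
    and br :: "'v \<Rightarrow> 'v \<Rightarrow> 'v" +
  fixes m :: nat
    and \<zeta> :: 'f
    and act :: "'f free_alg set \<Rightarrow> 'v \<Rightarrow> 'v"
  assumes m_ge_2: "m \<ge> 2"
    and primitive: "primitive_root_of_unity m \<zeta>"
    and act_closed: "\<And>h x. h \<in> carrier (taft_algebra m \<zeta>) \<Longrightarrow> x \<in> L \<Longrightarrow> act h x \<in> L"
    and act_add_right: "\<And>h x y. h \<in> carrier (taft_algebra m \<zeta>) \<Longrightarrow> x \<in> L \<Longrightarrow> y \<in> L \<Longrightarrow>
      act h (x + y) = act h x + act h y"
    and act_add_left: "\<And>h k x. h \<in> carrier (taft_algebra m \<zeta>) \<Longrightarrow>
      k \<in> carrier (taft_algebra m \<zeta>) \<Longrightarrow> x \<in> L \<Longrightarrow>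
      act (h \<oplus>\<^bsub>taft_algebra m \<zeta>\<^esub> k) x = act h x + act k x"
    and act_mult: "\<And>h k x. h \<in> carrier (taft_algebra m \<zeta>) \<Longrightarrow>
      k \<in> carrier (taft_algebra m \<zeta>) \<Longrightarrow> x \<in> L \<Longrightarrow>
      act (h \<otimes>\<^bsub>taft_algebra m \<zeta>\<^esub> k) x = act h (act k x)"
    and act_scalar: "\<And>r x. x \<in> L \<Longrightarrow> act (taft_class m \<zeta> (free_scalar r)) x = scale r x"
    and act_br: "\<And>f x y. x \<in> L \<Longrightarrow> y \<in> L \<Longrightarrow>
      act (taft_class m \<zeta> f) (br x y) =
        (\<Sum>(u, w)\<in>Poly_Mapping.keys (comult f). scale (Poly_Mapping.lookup (comult f) (u, w))
          (br (act (taft_class m \<zeta> (Poly_Mapping.single u 1)) x)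
              (act (taft_class m \<zeta> (Poly_Mapping.single w 1)) y)))"
begin

definition taft_invariant :: "'v set \<Rightarrow> bool"
  where "taft_invariant I \<longleftrightarrow> (\<forall>h\<in>carrier (taft_algebra m \<zeta>). \<forall>x\<in>I. act h x \<in> I)"

definition taft_simple :: bool
  where "taft_simple \<longleftrightarrow>
    commutator L L \<noteq> {0} \<and> (\<forall>I. lie_ideal I \<and> taft_invariant I \<longrightarrow> I = {0} \<or> I = L)"

definition component :: "nat \<Rightarrow> 'v set"
  where "component i = {a \<in> L. act (taft_c m \<zeta>) a = scale (\<zeta> ^ i) a}"

definition homogeneous :: "'v set \<Rightarrow> bool"
  where "homogeneous I \<longleftrightarrow>
    (\<forall>a\<in>I. \<exists>d. (\<forall>i<m. d i \<in> I \<inter> component i) \<and> a = (\<Sum>i<m. d i))"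

definition graded_simple :: bool
  where "graded_simple \<longleftrightarrow>
    commutator L L \<noteq> {0} \<and> (\<forall>I. lie_ideal I \<and> homogeneous I \<longrightarrow> I = {0} \<or> I = L)"

end

definition taft_lie_isomorphic ::
  "nat \<Rightarrow> 'f::field \<Rightarrow>
   ('f \<Rightarrow> 'v::ab_group_add \<Rightarrow> 'v) \<Rightarrow> 'v set \<Rightarrow> ('v \<Rightarrow> 'v \<Rightarrow> 'v) \<Rightarrow> ('f free_alg set \<Rightarrow> 'v \<Rightarrow> 'v) \<Rightarrow>
   ('f \<Rightarrow> 'w::ab_group_add \<Rightarrow> 'w) \<Rightarrow> 'w set \<Rightarrow> ('w \<Rightarrow> 'w \<Rightarrow> 'w) \<Rightarrow> ('f free_alg set \<Rightarrow> 'w \<Rightarrow> 'w) \<Rightarrow> bool"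
  where "taft_lie_isomorphic m \<zeta> scale L br act scale' L' br' act' \<longleftrightarrow>
    taft_module_lie_algebra scale L br m \<zeta> act \<and>
    taft_module_lie_algebra scale' L' br' m \<zeta> act' \<and>
    (\<exists>\<phi>. bij_betw \<phi> L L' \<and>
      (\<forall>x\<in>L. \<forall>y\<in>L. \<phi> (x + y) = \<phi> x + \<phi> y) \<and>
      (\<forall>r. \<forall>x\<in>L. \<phi> (scale r x) = scale' r (\<phi> x)) \<and>
      (\<forall>x\<in>L. \<forall>y\<in>L. \<phi> (br x y) = br' (\<phi> x) (\<phi> y)) \<and>
      (\<forall>h\<in>carrier (taft_algebra m \<zeta>). \<forall>x\<in>L. \<phi> (act h x) = act' h (\<phi> x)))"


section \<open>The module Lie algebras of copies\<close>

text \<open>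
  A tuple \<open>(a\<^sub>1, \<dots>, a\<^sub>m)\<close> of elements of \<open>B\<close> is a function on \<^typ>\<open>nat\<close> that vanishes outside
  \<open>{1..m}\<close>; the index cyclically preceding \<open>1\<close> is \<open>m\<close>.
\<close>

definition copies_carrier :: "nat \<Rightarrow> 'v::ab_group_add set \<Rightarrow> (nat \<Rightarrow> 'v) set"
  where "copies_carrier m B = {a. (\<forall>i\<in>{1..m}. a i \<in> B) \<and> (\<forall>i. i \<notin> {1..m} \<longrightarrow> a i = 0)}"

definition copies_scale :: "('f \<Rightarrow> 'v \<Rightarrow> 'v) \<Rightarrow> 'f \<Rightarrow> (nat \<Rightarrow> 'v) \<Rightarrow> nat \<Rightarrow> 'v"
  where "copies_scale scale r a = (\<lambda>i. scale r (a i))"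

definition copies_br ::
    "nat \<Rightarrow> ('v \<Rightarrow> 'v \<Rightarrow> 'v::ab_group_add) \<Rightarrow> (nat \<Rightarrow> 'v) \<Rightarrow> (nat \<Rightarrow> 'v) \<Rightarrow> nat \<Rightarrow> 'v"
  where "copies_br m br a b = (\<lambda>i. if i \<in> {1..m} then br (a i) (b i) else 0)"

definition cyclic_pred :: "nat \<Rightarrow> nat \<Rightarrow> nat"
  where "cyclic_pred m i = (if i = 1 then m else i - 1)"

definition copies_c :: "nat \<Rightarrow> (nat \<Rightarrow> 'v::ab_group_add) \<Rightarrow> nat \<Rightarrow> 'v"
  where "copies_c m a = (\<lambda>i. if i \<in> {1..m} then a (cyclic_pred m i) else 0)"

definition copies_v ::
    "nat \<Rightarrow> 'f::field \<Rightarrow> ('f \<Rightarrow> 'v::ab_group_add \<Rightarrow> 'v) \<Rightarrow> 'f \<Rightarrow> (nat \<Rightarrow> 'v) \<Rightarrow> nat \<Rightarrow> 'v"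
  where "copies_v m \<zeta> scale \<alpha> a =
    (\<lambda>i. if i \<in> {1..m} then scale (\<alpha> * \<zeta> ^ (i - 1)) (a i - a (cyclic_pred m i)) else 0)"

text \<open>
  The action of the Taft algebra determined by operators \<open>C\<close> and \<open>V\<close> for \<open>c\<close> and \<open>v\<close>: words act by
  composition, and a class acts through any of its representatives.  For linear operators that
  satisfy the defining relations the choice of representative is immaterial.
\<close>

primrec gen_act :: "('v \<Rightarrow> 'v) \<Rightarrow> ('v \<Rightarrow> 'v) \<Rightarrow> taft_gen \<Rightarrow> 'v \<Rightarrow> 'v"
  where
    "gen_act C V Gen_c = C"
  | "gen_act C V Gen_v = V"

definition word_act :: "('v \<Rightarrow> 'v) \<Rightarrow> ('v \<Rightarrow> 'v) \<Rightarrow> taft_word \<Rightarrow> 'v \<Rightarrow> 'v"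
  where "word_act C V w x = foldr (gen_act C V) (letters w) x"

definition free_act :: "('f::field \<Rightarrow> 'v::ab_group_add \<Rightarrow> 'v) \<Rightarrow> ('v \<Rightarrow> 'v) \<Rightarrow> ('v \<Rightarrow> 'v) \<Rightarrow>
    'f free_alg \<Rightarrow> 'v \<Rightarrow> 'v"
  where "free_act scale C V f x =
    (\<Sum>w\<in>Poly_Mapping.keys f. scale (Poly_Mapping.lookup f w) (word_act C V w x))"

definition taft_act :: "('f::field \<Rightarrow> 'v::ab_group_add \<Rightarrow> 'v) \<Rightarrow> ('v \<Rightarrow> 'v) \<Rightarrow> ('v \<Rightarrow> 'v) \<Rightarrow>
    'f free_alg set \<Rightarrow> 'v \<Rightarrow> 'v"
  where "taft_act scale C V h = free_act scale C V (SOME f. f \<in> h)"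

definition copies_act :: "nat \<Rightarrow> 'f::field \<Rightarrow> ('f \<Rightarrow> 'v::ab_group_add \<Rightarrow> 'v) \<Rightarrow> 'f \<Rightarrow>
    'f free_alg set \<Rightarrow> (nat \<Rightarrow> 'v) \<Rightarrow> nat \<Rightarrow> 'v"
  where "copies_act m \<zeta> scale \<alpha> =
    taft_act (copies_scale scale) (copies_c m) (copies_v m \<zeta> scale \<alpha>)"

end

theory Submission
  imports Defs
begin

text \<open>
  A nonzero \<open>c\<close>-invariant ideal contains a minimal one, \<open>J\<close>, and semisimplicity forces \<open>[J, J] = J\<close>;
  then \<open>v[a, b] = [ca, vb] + [va, b]\<close> shows \<open>vJ \<subseteq> J\<close>, so \<open>J = L\<close>.  This is graded simplicity.

  Let \<open>B\<close> be a minimal ideal.  Distinct ideals among the \<open>c\<^sup>iB\<close> commute, and they span \<open>L\<close>, so no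
  Killing form is needed to see that \<open>B\<close> is simple.  Evaluating \<open>v\<close> on commuting elements gives
  \<open>v(c\<^sup>iB) \<subseteq> c\<^sup>iB + c\<^sup>i\<^sup>+\<^sup>1B\<close>, and both components of \<open>v\<close> lie in the centroid of \<open>c\<^sup>iB\<close> (up to \<open>c\<close>),
  hence are scalars.  The relation \<open>vc = \<zeta>cv\<close> then leaves \<open>vd = \<alpha>\<zeta>\<^sup>i(d - \<zeta>cd)\<close> on \<open>c\<^sup>iB\<close>.  If
  \<open>c\<^sup>iB = c\<^sup>jB\<close> with \<open>i < j < m\<close>, comparing coefficients gives \<open>\<alpha> = 0\<close>; so \<open>vL \<noteq> 0\<close> makes \<open>L\<close> the direct
  sum of \<open>B, cB, \<dots>, c\<^sup>m\<^sup>-\<^sup>1B\<close>, and \<open>(a\<^sub>1, \<dots>, a\<^sub>m) \<mapsto> \<Sum> c\<^sup>i\<^sup>-\<^sup>1a\<^sub>i\<close> is the isomorphism.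
\<close>

section \<open>The action of the Taft algebra\<close>

lemma ring_free_ring: "ring (free_ring :: 'f::field free_alg ring)"
proof (rule ringI)
  show "abelian_group (free_ring :: 'f free_alg ring)"
  proof (rule abelian_groupI)
    fix x :: "'f free_alg"
    have "- x + x = 0" by simp
    then show "\<exists>y\<in>carrier free_ring. y \<oplus>\<^bsub>free_ring\<^esub> x = \<zero>\<^bsub>free_ring\<^esub>"
      unfolding free_ring_def by (auto intro!: exI[of _ "- x"])
  qed (simp_all add: free_ring_def ac_simps)
  show "Group.monoid (free_ring :: 'f free_alg ring)"
    by (rule monoidI) (simp_all add: free_ring_def mult.assoc)
qed (simp_all add: free_ring_def distrib_left distrib_right)

lemma ideal_taft_ideal: "ideal (taft_ideal m \<zeta>) (free_ring :: 'f::field free_alg ring)"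
  unfolding taft_ideal_def
  by (rule ring.genideal_ideal[OF ring_free_ring]) (simp add: free_ring_def)

lemma taft_class_hom: "taft_class m \<zeta> \<in> ring_hom free_ring (taft_algebra m \<zeta>)"
proof -
  have "taft_class m \<zeta> = (+>\<^bsub>free_ring\<^esub>) (taft_ideal m \<zeta>)"
    by (simp add: taft_class_def fun_eq_iff)
  then show ?thesis
    using ideal.rcos_ring_hom[OF ideal_taft_ideal] by (simp add: taft_algebra_def)
qed

lemma taft_class_carrier [simp]: "taft_class m \<zeta> f \<in> carrier (taft_algebra m \<zeta>)"
  using ring_hom_closed[OF taft_class_hom, of f] by (simp add: free_ring_def)

lemma taft_class_add:
  "taft_class m \<zeta> (f + g) = taft_class m \<zeta> f \<oplus>\<^bsub>taft_algebra m \<zeta>\<^esub> taft_class m \<zeta> g"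
  using ring_hom_add[OF taft_class_hom, of f g] by (simp add: free_ring_def)

lemma taft_class_mult:
  "taft_class m \<zeta> (f * g) = taft_class m \<zeta> f \<otimes>\<^bsub>taft_algebra m \<zeta>\<^esub> taft_class m \<zeta> g"
  using ring_hom_mult[OF taft_class_hom, of f g] by (simp add: free_ring_def)

text \<open>A coset is nonempty and is represented by any of its elements. This lets
  \<open>taft_act\<close>, which chooses a representative, be compared with an action on
  classes.\<close>

lemma taft_class_some_eq:
  assumes "h \<in> carrier (taft_algebra m \<zeta>)"
  shows "taft_class m \<zeta> (SOME f. f \<in> h) = h"
proof -
  interpret ideal "taft_ideal m \<zeta>" free_ring by (rule ideal_taft_ideal)
  obtain f where f: "f \<in> carrier free_ring" "h = taft_class m \<zeta> f"
    using assms by (auto simp: taft_algebra_def FactRing_def A_RCOSETS_def' taft_class_def)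
  have "f \<in> h" using a_rcos_self[OF f(1)] f(2) by (simp add: taft_class_def)
  then have "(SOME f. f \<in> h) \<in> h" by (rule someI)
  then have "taft_class m \<zeta> f = taft_class m \<zeta> (SOME f. f \<in> h)"
    using a_repr_independence'[of "SOME f. f \<in> h" f] f
    by (simp add: taft_class_def)
  then show ?thesis using f(2) by simp
qed

text \<open>The relations generate \<open>taft_ideal\<close>, so they become equations between
  classes; \<open>C_power\<close> and \<open>V_C\<close> obtain c^m = 1 and vc = \<zeta>cv in this
  way.\<close>

lemma taft_class_eqI: "f - g \<in> taft_relations m \<zeta> \<Longrightarrow> taft_class m \<zeta> f = taft_class m \<zeta> g"
proof -
  assume a: "f - g \<in> taft_relations m \<zeta>"
  interpret ideal "taft_ideal m \<zeta>" free_ring by (rule ideal_taft_ideal)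
  have "taft_relations m \<zeta> \<subseteq> taft_ideal m \<zeta>"
    unfolding taft_ideal_def by (rule genideal_self) (simp add: free_ring_def)
  with a have "f - g \<in> taft_ideal m \<zeta>" by auto
  moreover have "f \<in> taft_ideal m \<zeta> +>\<^bsub>free_ring\<^esub> g" if "f - g \<in> taft_ideal m \<zeta>"
    unfolding a_r_coset_def' using that
    by (auto simp: free_ring_def intro!: bexI[of _ "f - g"])
  ultimately show ?thesis
    using a_repr_independence'[of f g] by (simp add: taft_class_def free_ring_def)
qed

lemma sum_single_lookup: "(\<Sum>w\<in>Poly_Mapping.keys f. Poly_Mapping.single w (Poly_Mapping.lookup f w)) = f"
  by (rule poly_mapping_eqI)
    (auto simp: lookup_sum lookup_single when_def sum.delta' in_keys_iff intro: sum.neutral)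

section \<open>The operators of c and v on L\<close>

context taft_module_lie_algebra
begin

abbreviation C :: "'v \<Rightarrow> 'v" where "C \<equiv> act (taft_c m \<zeta>)"
abbreviation V :: "'v \<Rightarrow> 'v" where "V \<equiv> act (taft_v m \<zeta>)"

lemma act_class_closed [simp]: "x \<in> L \<Longrightarrow> act (taft_class m \<zeta> f) x \<in> L"
  by (simp add: act_closed)

lemma act_class_add:
  "x \<in> L \<Longrightarrow> act (taft_class m \<zeta> (f + g)) x = act (taft_class m \<zeta> f) x + act (taft_class m \<zeta> g) x"
  by (simp add: taft_class_add act_add_left)

lemma act_class_mult:
  "x \<in> L \<Longrightarrow> act (taft_class m \<zeta> (f * g)) x = act (taft_class m \<zeta> f) (act (taft_class m \<zeta> g) x)"
  by (simp add: taft_class_mult act_mult)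

lemma act_class_zero: "x \<in> L \<Longrightarrow> act (taft_class m \<zeta> 0) x = 0"
  using act_scalar[of x 0] by (simp add: free_scalar_def)

lemma act_class_one: "x \<in> L \<Longrightarrow> act (taft_class m \<zeta> 1) x = x"
  using act_scalar[of x 1] by (simp add: free_scalar_def)

lemma act_class_sum:
  "x \<in> L \<Longrightarrow> act (taft_class m \<zeta> (\<Sum>i\<in>A. f i)) x = (\<Sum>i\<in>A. act (taft_class m \<zeta> (f i)) x)"
  by (induction A rule: infinite_finite_induct) (simp_all add: act_class_zero act_class_add)

lemma act_class_power: "x \<in> L \<Longrightarrow> act (taft_class m \<zeta> (f ^ n)) x = (act (taft_class m \<zeta> f) ^^ n) x"
proof (induction n)
  case (Suc n)
  then show ?case by (simp add: act_class_mult)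
qed (simp add: act_class_one)

lemma act_word: "x \<in> L \<Longrightarrow> act (taft_class m \<zeta> (Poly_Mapping.single (Word gs) 1)) x = word_act C V (Word gs) x"
proof (induction gs)
  case Nil
  then show ?case using act_class_one by (simp add: word_act_def zero_taft_word_def flip: single_one)
next
  case (Cons g gs)
  have "Poly_Mapping.single (Word (g # gs)) 1 = (free_gen g * Poly_Mapping.single (Word gs) 1 :: 'f free_alg)"
    by (simp add: free_gen_def mult_single plus_taft_word_def)
  moreover have "gen_act C V g = act (taft_class m \<zeta> (free_gen g))"
    by (cases g) auto
  ultimately show ?case using Cons by (simp add: act_class_mult word_act_def)
qed

lemma word_act_closed: "x \<in> L \<Longrightarrow> word_act C V w x \<in> L"
  using act_word[of x "letters w"] act_class_closed[of x] by (metis taft_word.collapse)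

text \<open>An element of the free algebra is the sum of its monomials, and a monomial acts by a
  scalar times a composition of \<open>C\<close> and \<open>V\<close>. So these two operators
  determine the whole action.\<close>

lemma act_class:
  assumes "x \<in> L"
  shows "act (taft_class m \<zeta> f) x = free_act scale C V f x"
proof -
  have "act (taft_class m \<zeta> (Poly_Mapping.single w r)) x = scale r (word_act C V w x)" for w r
  proof -
    have "Poly_Mapping.single w r = free_scalar r * Poly_Mapping.single w 1"
      by (simp add: free_scalar_def mult_single)
    then show ?thesis
      using assms act_word[of x "letters w"] by (simp add: act_class_mult act_scalar word_act_closed)
  qed
  then show ?thesis
    using assms act_class_sum[of x "\<lambda>w. Poly_Mapping.single w (Poly_Mapping.lookup f w)" "Poly_Mapping.keys f"]
    by (simp add: sum_single_lookup free_act_def)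
qed

lemma C_power: "x \<in> L \<Longrightarrow> (C ^^ m) x = x"
  using act_class_power[of x "free_gen Gen_c" m]
    taft_class_eqI[of "free_gen Gen_c ^ m" 1 m \<zeta>]
  by (simp add: taft_relations_def act_class_one)

lemma V_C: "x \<in> L \<Longrightarrow> V (C x) = scale \<zeta> (C (V x))"
  using taft_class_eqI[of "free_gen Gen_v * free_gen Gen_c" "free_scalar \<zeta> * free_gen Gen_c * free_gen Gen_v" m \<zeta>]
    act_class_mult[of x "free_gen Gen_v" "free_gen Gen_c"]
    act_class_mult[of x "free_scalar \<zeta> * free_gen Gen_c" "free_gen Gen_v"]
    act_class_mult[of "V x" "free_scalar \<zeta>" "free_gen Gen_c"]
  by (simp add: taft_relations_def act_scalar)

lemma C_br: "x \<in> L \<Longrightarrow> y \<in> L \<Longrightarrow> C (br x y) = br (C x) (C y)"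
  using act_br[of x y "free_gen Gen_c"]
  by (simp add: comult_def free_gen_def comult_word_def)

lemma V_br: 
  assumes "x \<in> L" "y \<in> L" 
  shows "V (br x y) = br (C x) (V y) + br (V x) y"
proof -
  have c: "comult (free_gen Gen_v :: 'f free_alg) = comult_gen Gen_v"
    by (simp add: comult_def free_gen_def comult_word_def)
  \<comment> \<open>The two terms of the coproduct of v have different pairs of words, so nothing
    cancels.\<close>
  have k: "Poly_Mapping.keys (comult_gen Gen_v :: _ \<Rightarrow>\<^sub>0 'f) = {(Word [Gen_c], Word [Gen_v]), (Word [Gen_v], 0)}"
    by (auto simp: in_keys_iff lookup_add lookup_single when_def zero_taft_word_def split: if_splits)
  \<comment> \<open>The right factor of the second term is the empty word \<open>0\<close>, which
    stands for 1.\<close>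
  have "act (taft_class m \<zeta> (Poly_Mapping.single 0 1)) y = y"
    using act_class_one[OF assms(2)] by simp
  then show ?thesis
    using act_br[OF assms, of "free_gen Gen_v"]
    unfolding c k by (simp add: lookup_add lookup_single when_def zero_taft_word_def free_gen_def)
qed

end


section \<open>Semisimple Lie algebras\<close>

text \<open>
  The map \<open>f\<close> is linear only on \<open>S\<close>.  If \<open>p(f) x = 0\<close> with \<open>p\<close> of least degree and \<open>p = (X - r) q\<close>, then
  \<open>q(f) x\<close> is an eigenvector.
\<close>

lemma eigenvector_exists:
  fixes scale :: "'f::alg_closed_field \<Rightarrow> 'v::ab_group_add \<Rightarrow> 'v"
  assumes "vector_space scale"
    and S: "module.subspace scale S" "S \<subseteq> module.span scale T" "finite T" "S \<noteq> {0}"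
    and f_closed: "\<And>x. x \<in> S \<Longrightarrow> f x \<in> S"
    and f_add: "\<And>x y. x \<in> S \<Longrightarrow> y \<in> S \<Longrightarrow> f (x + y) = f x + f y"
    and f_scale: "\<And>r x. x \<in> S \<Longrightarrow> f (scale r x) = scale r (f x)"
  shows "\<exists>x\<in>S. \<exists>r. x \<noteq> 0 \<and> f x = scale r x"
proof -
  interpret vector_space scale by fact
  obtain x where x: "x \<in> S" "x \<noteq> 0"
    using S(4) subspace_0[OF S(1)] by blast
  define u where "u i = (f ^^ i) x" for i
  have u_S: "u i \<in> S" for i
    by (induction i) (simp_all add: u_def x f_closed)
  have f_sum: "f (\<Sum>i\<in>A. scale (c i) (u i)) = (\<Sum>i\<in>A. scale (c i) (u (Suc i)))" for A c
  proof (induction A rule: infinite_finite_induct)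
    case (insert j A)
    have "(\<Sum>i\<in>A. scale (c i) (u i)) \<in> S"
      by (intro subspace_sum subspace_scale S(1) u_S)
    moreover have "scale (c j) (u j) \<in> S" by (intro subspace_scale S(1) u_S)
    moreover have "f (u j) = u (Suc j)" by (simp add: u_def)
    ultimately show ?case
      using insert by (simp add: f_add f_scale[OF u_S])
  qed (use f_scale[of x 0] x in simp_all)
  \<comment> \<open>If no iterate depended on the earlier ones, \<open>span T\<close> would contain
    independent sets of every size.\<close>
  have ex: "\<exists>n. u n \<in> span (u ` {..<n})"
  proof (rule ccontr)
    assume "\<nexists>n. u n \<in> span (u ` {..<n})"
    then have new: "u n \<notin> span (u ` {..<n})" for n by blast
    have "independent (u ` {..<n}) \<and> card (u ` {..<n}) = n" for n
    proof (induction n)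
      case (Suc n)
      have "u n \<notin> u ` {..<n}" using new[of n] span_base[of "u n" "u ` {..<n}"] by blast
      with Suc new[of n] show ?case
        by (simp add: lessThan_Suc independent_insertI)
    qed (simp add: independent_empty)
    moreover have "u ` {..<n} \<subseteq> span T" for n using u_S S(2) by blast
    ultimately have "n \<le> card T" for n
      using independent_span_bound[OF S(3)] by metis
    then show False using not_less_eq_eq by blast
  qed
  define n where "n = (LEAST n. u n \<in> span (u ` {..<n}))"
  have n: "u n \<in> span (u ` {..<n})"
    unfolding n_def using ex by (rule LeastI_ex)
  have n_min: "u k \<notin> span (u ` {..<k})" if "k < n" for k
    using that not_less_Least unfolding n_def by blast
  obtain k where k: "n = Suc k"
    using n x by (cases n) (auto simp: u_def)
  \<comment> \<open>\<open>M\<close> describes the span by coefficient families indexed below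
    \<open>n\<close>, which can then be read as polynomial coefficients.\<close>
  define M where "M = range (\<lambda>c. \<Sum>i<n. scale (c i) (u i))"
  have M: "(\<Sum>i<n. scale (c i) (u i)) \<in> M" for c
    unfolding M_def by (rule rangeI)
  have "span (u ` {..<n}) \<subseteq> M"
  proof (rule span_minimal)
    show "u ` {..<n} \<subseteq> M"
    proof clarify
      fix j assume "j < n"
      then show "u j \<in> M"
        using M[of "\<lambda>i. if i = j then 1 else 0"]
        by (simp add: if_distrib[of "\<lambda>r. scale r _"] sum.delta' cong: if_cong)
    qed
    show "subspace M"
    proof (rule subspaceI)
      show "0 \<in> M" using M[of "\<lambda>i. 0"] by simp
    next
      fix y z assume "y \<in> M" "z \<in> M"
      then obtain a b where "y = (\<Sum>i<n. scale (a i) (u i))" "z = (\<Sum>i<n. scale (b i) (u i))"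
        unfolding M_def by blast
      then show "y + z \<in> M"
        using M[of "\<lambda>i. a i + b i"] by (simp add: scale_left_distrib sum.distrib)
    next
      fix r y assume "y \<in> M"
      then obtain a where "y = (\<Sum>i<n. scale (a i) (u i))"
        unfolding M_def by blast
      then show "scale r y \<in> M"
        using M[of "\<lambda>i. r * a i"] by (simp add: scale_sum_right)
    qed
  qed
  with n obtain c where c: "u n = (\<Sum>i<n. scale (c i) (u i))"
    unfolding M_def by blast
  define p where "p = monom 1 n - (\<Sum>i<n. monom (c i) i)"
  have cp: "coeff p i = (if i = n then 1 else if i < n then - c i else 0)" for i
    by (auto simp: p_def coeff_sum sum.delta')
  have dp: "degree p = n"
    by (rule antisym) (auto intro!: degree_le le_degree simp: cp)
  obtain r where "poly p r = 0"
    using alg_closed_imp_poly_has_root[of p] dp k by auto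
  then obtain q where q: "p = [:- r, 1:] * q"
    by (auto simp: poly_eq_0_iff_dvd)
  have q0: "q \<noteq> 0" using q cp[of n] by auto
  have dq: "degree q = k"
    using dp q0 k unfolding q by (subst (asm) degree_mult_eq) auto
  have lq: "coeff q k = 1"
  proof -
    have "coeff p n = coeff q k"
      using dq by (simp add: q k coeff_eq_0)
    then show ?thesis using cp[of n] by simp
  qed
  define y where "y = (\<Sum>i<n. scale (coeff q i) (u i))"
  have y_S: "y \<in> S"
    unfolding y_def by (intro subspace_sum subspace_scale S(1) u_S)
  have y_split: "y = (\<Sum>i<k. scale (coeff q i) (u i)) + u k"
    by (simp add: y_def k lq)
  \<comment> \<open>\<open>q\<close> is monic of degree k < n, so y = 0 would express
    \<open>u k\<close> through earlier iterates, against the choice of \<open>n\<close>.\<close>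
  have "y \<noteq> 0"
  proof
    assume "y = 0"
    then have "u k = - (\<Sum>i<k. scale (coeff q i) (u i))"
      using y_split by (simp add: eq_neg_iff_add_eq_0 add.commute)
    moreover have "- (\<Sum>i<k. scale (coeff q i) (u i)) \<in> span (u ` {..<k})"
      by (intro span_neg span_sum span_scale span_base) auto
    ultimately show False using n_min[of k] k by simp
  qed
  moreover have "f y = scale r y"
  proof -
    have "0 = (\<Sum>i<Suc n. scale (coeff p i) (u i))"
      by (simp add: cp c sum_negf)
    \<comment> \<open>Coefficientwise p = X q - r q, where \<open>pCons 0 q\<close> is X q; the two
      sums are f y and r y.\<close>
    also have "\<dots> = (\<Sum>i<Suc n. scale (coeff (pCons 0 q) i) (u i)) - (\<Sum>i<Suc n. scale (r * coeff q i) (u i))"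
      unfolding q sum_subtractf[symmetric] scale_left_diff_distrib[symmetric]
      by (intro sum.cong refl arg_cong2[of _ _ _ _ scale]) simp
    also have "(\<Sum>i<Suc n. scale (coeff (pCons 0 q) i) (u i)) = f y"
      unfolding y_def f_sum by (subst sum.lessThan_Suc_shift) simp
    also have "(\<Sum>i<Suc n. scale (r * coeff q i) (u i)) = scale r y"
      using dq k by (simp add: y_def coeff_eq_0 scale_sum_right scale_right_distrib)
    finally show ?thesis by simp
  qed
  ultimately show ?thesis using y_S by blast
qed

section \<open>Ideals, commutators and semisimplicity\<close>

context lie_algebra
begin

lemma zero_in_L [simp]: "0 \<in> L" by (rule subspace_0[OF subspace_carrier])
lemma add_in_L [simp]: "x \<in> L \<Longrightarrow> y \<in> L \<Longrightarrow> x + y \<in> L"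
  by (rule subspace_add[OF subspace_carrier])
lemma diff_in_L [simp]: "x \<in> L \<Longrightarrow> y \<in> L \<Longrightarrow> x - y \<in> L"
  by (rule subspace_diff[OF subspace_carrier])
lemma scale_in_L [simp]: "x \<in> L \<Longrightarrow> scale r x \<in> L"
  by (rule subspace_scale[OF subspace_carrier])
lemma neg_in_L [simp]: "x \<in> L \<Longrightarrow> - x \<in> L"
  by (rule subspace_neg[OF subspace_carrier])
lemma sum_in_L [simp]: "(\<And>i. i \<in> A \<Longrightarrow> f i \<in> L) \<Longrightarrow> (\<Sum>i\<in>A. f i) \<in> L"
  by (rule subspace_sum[OF subspace_carrier])

lemma br_zero_left [simp]: "x \<in> L \<Longrightarrow> br 0 x = 0"
  using br_scale_left[of 0 x 0] by simp
lemma br_zero_right [simp]: "x \<in> L \<Longrightarrow> br x 0 = 0"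
  using br_scale_right[of x 0 0] by simp

lemma br_anticomm: 
  assumes "x \<in> L" "y \<in> L" 
  shows "br x y = - br y x"
proof -
  have "br x y + br y x = br (x + y) (x + y)"
    using assms br_add_left[of x y "x + y"] br_add_right[of x x y] br_add_right[of y x y]
      br_self[of x] br_self[of y] by simp
  also have "\<dots> = 0" using assms by (intro br_self) simp
  finally show ?thesis by (simp add: eq_neg_iff_add_eq_0)
qed

lemma br_neg_left: "x \<in> L \<Longrightarrow> y \<in> L \<Longrightarrow> br (- x) y = - br x y"
  using br_scale_left[of x y "-1"] by simp
lemma br_diff_left: "x \<in> L \<Longrightarrow> y \<in> L \<Longrightarrow> z \<in> L \<Longrightarrow> br (x - y) z = br x z - br y z"
  using br_add_left[of x "- y" z] by (simp add: br_neg_left)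
lemma br_sum_left: "y \<in> L \<Longrightarrow> (\<And>i. i \<in> A \<Longrightarrow> f i \<in> L) \<Longrightarrow> br (\<Sum>i\<in>A. f i) y = (\<Sum>i\<in>A. br (f i) y)"
  by (induction A rule: infinite_finite_induct) (simp_all add: br_add_left)

lemma lie_idealD:
  assumes "lie_ideal I"
  shows "subspace I" "I \<subseteq> L" "\<And>x y. x \<in> L \<Longrightarrow> y \<in> I \<Longrightarrow> br x y \<in> I"
    "\<And>x y. x \<in> L \<Longrightarrow> y \<in> I \<Longrightarrow> br y x \<in> I"
proof -
  show *: "subspace I" "I \<subseteq> L" "\<And>x y. x \<in> L \<Longrightarrow> y \<in> I \<Longrightarrow> br x y \<in> I"
    using assms by (auto simp: lie_ideal_def)
  show "br y x \<in> I" if "x \<in> L" "y \<in> I" for x y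
  proof -
    have "br y x = - br x y" using that *(2) by (intro br_anticomm) auto
    then show ?thesis using *(1) *(3)[OF that] by (simp add: subspace_neg)
  qed
qed

text \<open>Strict inclusion lowers the dimension, so a member of least dimension is minimal. The
  predicate is general because it is applied both to nonzero ideals and to nonzero c-stable
  ideals.\<close>

lemma finite_dimensional_minimal:
  assumes "fin_dim" "P S" and P: "\<And>S. P S \<Longrightarrow> subspace S \<and> S \<subseteq> L"
  shows "\<exists>T. P T \<and> T \<subseteq> S \<and> (\<forall>T'. P T' \<and> T' \<subseteq> T \<longrightarrow> T' = T)"
proof -
  obtain G where G: "finite G" "span G = L" using assms(1) by (auto simp: fin_dim_def)
  have dim_less: "dim T' < dim T" if sub: "P T" "P T'" "T' \<subset> T" for T T'
  proof -
    obtain b where b: "b \<subseteq> T'" "independent b" "T' \<subseteq> span b" "card b = dim T'"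
      using basis_exists by blast
    obtain b2 where b2: "b2 \<subseteq> T" "independent b2" "T \<subseteq> span b2" "card b2 = dim T"
      using basis_exists by blast
    obtain x where x: "x \<in> T" "x \<notin> T'" using sub(3) by blast
    have fin: "finite b2" using independent_span_bound[OF G(1) b2(2)] b2(1) P[OF sub(1)] G(2) by auto
    have "span b \<subseteq> T'" using b(1) P[OF sub(2)] span_minimal by blast
    with x have "x \<notin> span b" by blast
    then have "independent (insert x b)" "x \<notin> b"
      using b(2) independent_insertI span_base by blast+
    moreover have "insert x b \<subseteq> span b2" using x b(1) sub(3) b2(3) by blast
    ultimately have "finite b" "card (insert x b) \<le> card b2"
      using independent_span_bound[OF fin, of "insert x b"] by (auto simp del: card_insert_disjoint)
    with \<open>x \<notin> b\<close> b(4) b2(4) show ?thesis by simp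
  qed
  have "\<exists>T. (P T \<and> T \<subseteq> S) \<and> (\<forall>T'. P T' \<and> T' \<subseteq> S \<longrightarrow> dim T \<le> dim T')"
    using ex_has_least_nat[of "\<lambda>T. P T \<and> T \<subseteq> S" S dim] assms(2) by simp
  then show ?thesis
    using dim_less by (meson leD order_trans psubsetI)
qed

lemma commutator_subset_ideal:
  assumes "lie_ideal I"
  shows "commutator I I \<subseteq> I"
  unfolding commutator_def
  using lie_idealD[OF assms] by (intro span_minimal) blast+

text \<open>By the Jacobi identity, bracketing with x is a derivation, so [x, [a, b]] is a sum of
  brackets of elements of I. The y with [x, y] in [I, I] form a subspace, so generators
  suffice.\<close>

lemma lie_ideal_commutator:
  assumes "lie_ideal I"
  shows "lie_ideal (commutator I I)"
proof -
  note I = lie_idealD[OF assms]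
  have sub: "subspace {y \<in> L. br x y \<in> commutator I I}" if "x \<in> L" for x
    unfolding commutator_def using that
    by (intro subspaceI) (auto simp: br_add_right br_scale_right span_add span_scale span_zero)
  have stable: "commutator I I \<subseteq> {y \<in> L. br x y \<in> commutator I I}" if x: "x \<in> L" for x
  proof -
    have "br a b \<in> L \<and> br x (br a b) \<in> commutator I I" if ab: "a \<in> I" "b \<in> I" for a b
    proof -
      have abL: "a \<in> L" "b \<in> L" using ab I(2) by auto
      have "br a (br b x) = - br (br b x) a" "br b (br x a) = - br (br x a) b"
        by (intro br_anticomm br_closed abL x)+
      with jacobi[OF x abL] have "br x (br a b) = br (br b x) a + br (br x a) b"
        by (simp add: algebra_simps)
      moreover have "br (br b x) a \<in> commutator I I" "br (br x a) b \<in> commutator I I"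
        unfolding commutator_def
        using ab I(3)[OF x ab(1)] I(4)[OF x ab(2)] I(3)[OF x ab(2)] I(4)[OF x ab(1)] by (auto intro!: span_base)
      ultimately show ?thesis
        using br_closed[OF abL] by (simp add: commutator_def span_add)
    qed
    then have "{br a b |a b. a \<in> I \<and> b \<in> I} \<subseteq> {y \<in> L. br x y \<in> commutator I I}"
      by blast
    from span_minimal[OF this sub[OF x]] show ?thesis
      by (simp add: commutator_def)
  qed
  moreover have "subspace (commutator I I)" by (simp add: commutator_def)
  moreover have "commutator I I \<subseteq> L"
    using commutator_subset_ideal[OF assms] I(2) by (rule order_trans)
  ultimately show ?thesis
    unfolding lie_ideal_def by blast
qed

lemma commutator_ne_zero_iff:
  "commutator A B \<noteq> {0} \<longleftrightarrow> (\<exists>x\<in>A. \<exists>y\<in>B. br x y \<noteq> 0)"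
proof
  assume *: "commutator A B \<noteq> {0}"
  show "\<exists>x\<in>A. \<exists>y\<in>B. br x y \<noteq> 0"
  proof (rule ccontr)
    assume "\<not> ?thesis"
    then have "commutator A B \<subseteq> {0}"
      unfolding commutator_def by (intro span_minimal) auto
    moreover have "0 \<in> commutator A B" by (simp add: commutator_def span_zero)
    ultimately show False using * by blast
  qed
next
  assume "\<exists>x\<in>A. \<exists>y\<in>B. br x y \<noteq> 0"
  then obtain x y where xy: "x \<in> A" "y \<in> B" "br x y \<noteq> 0" by blast
  then have "br x y \<in> commutator A B"
    unfolding commutator_def by (blast intro: span_base)
  with xy(3) show "commutator A B \<noteq> {0}" by blast
qed

text \<open>A nonzero abelian ideal would be solvable after one step. Semisimplicity enters the
  argument only through this fact.\<close>

lemma semisimple_commutator_ne_zero: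
  assumes "semisimple" "lie_ideal I" "I \<noteq> {0}"
  shows "commutator I I \<noteq> {0}"
proof
  assume "commutator I I = {0}"
  then have "derived_series I 1 = {0}" by simp
  then show False using assms unfolding semisimple_def solvable_def by blast
qed

text \<open>The centre is an abelian ideal.\<close>

lemma semisimple_centre_zero:
  assumes "semisimple" "z \<in> L" "\<And>x. x \<in> L \<Longrightarrow> br z x = 0"
  shows "z = 0"
proof -
  let ?Z = "{z \<in> L. \<forall>x\<in>L. br z x = 0}"
  have "br x y = 0" if "x \<in> L" "y \<in> ?Z" for x y
    using that br_anticomm[OF that(1), of y] by auto
  moreover have "subspace ?Z"
    by (intro subspaceI) (auto simp: br_add_left br_scale_left)
  ultimately have "lie_ideal ?Z"
    unfolding lie_ideal_def by auto
  moreover have "commutator ?Z ?Z = {0}"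
    using commutator_ne_zero_iff[of ?Z ?Z] by blast
  ultimately have "?Z = {0}" using semisimple_commutator_ne_zero assms(1) by blast
  then show ?thesis using assms by blast
qed

lemma lie_algebra_lie_ideal:
  assumes "lie_ideal D"
  shows "lie_algebra scale D br"
  using lie_idealD[OF assms]
  by unfold_locales (auto simp: subset_iff br_add_left br_add_right br_scale_left br_scale_right
      br_self jacobi)

end

text \<open>Schur's argument: f has an eigenvector, and because f commutes with bracketing by x, the
  eigenspace is a nonzero ideal.\<close>

lemma centroid_scalar:
  fixes scale :: "'f::alg_closed_field \<Rightarrow> 'v::ab_group_add \<Rightarrow> 'v"
  assumes "lie_algebra scale L br" "lie_algebra.simple scale L br"
    and T: "finite T" "L \<subseteq> module.span scale T"
    and f_closed: "\<And>x. x \<in> L \<Longrightarrow> f x \<in> L"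
    and f_add: "\<And>x y. x \<in> L \<Longrightarrow> y \<in> L \<Longrightarrow> f (x + y) = f x + f y"
    and f_scale: "\<And>r x. x \<in> L \<Longrightarrow> f (scale r x) = scale r (f x)"
    and f_br: "\<And>x y. x \<in> L \<Longrightarrow> y \<in> L \<Longrightarrow> f (br x y) = br x (f y)"
  shows "\<exists>r. \<forall>x\<in>L. f x = scale r x"
proof -
  interpret lie_algebra scale L br by fact
  have "L \<noteq> {0}"
    using assms(2) by (auto simp: simple_def commutator_ne_zero_iff)
  then obtain x r where x: "x \<in> L" "x \<noteq> 0" "f x = scale r x"
    using eigenvector_exists[OF vector_space_axioms subspace_carrier T(2,1), of f]
      f_closed f_add f_scale by blast
  have "lie_ideal {y \<in> L. f y = scale r y}"
    unfolding lie_ideal_def using f_scale[of 0 0]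
    by (auto intro!: subspaceI simp: f_add f_scale f_br br_closed br_scale_right
        scale_right_distrib mult.commute)
  moreover have "{y \<in> L. f y = scale r y} \<noteq> {0}" using x by blast
  ultimately have "{y \<in> L. f y = scale r y} = L"
    using assms(2) unfolding simple_def by blast
  then show ?thesis by blast
qed

section \<open>Minimal ideals\<close>

context lie_algebra
begin

definition minimal_ideal :: "'v set \<Rightarrow> bool"
  where "minimal_ideal D \<longleftrightarrow>
    lie_ideal D \<and> D \<noteq> {0} \<and> (\<forall>I. lie_ideal I \<and> I \<subseteq> D \<longrightarrow> I = {0} \<or> I = D)"

lemma lie_ideal_Int: "lie_ideal I \<Longrightarrow> lie_ideal J \<Longrightarrow> lie_ideal (I \<inter> J)"
  unfolding lie_ideal_def using subspace_inter by blast

lemma minimal_ideal_exists: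
  assumes "fin_dim" "L \<noteq> {0}"
  shows "\<exists>D. minimal_ideal D"
proof -
  have "lie_ideal L" by (simp add: lie_ideal_def subspace_carrier br_closed)
  then obtain D where D: "lie_ideal D \<and> D \<noteq> {0}"
      "\<And>I. (lie_ideal I \<and> I \<noteq> {0}) \<and> I \<subseteq> D \<Longrightarrow> I = D"
    using finite_dimensional_minimal[OF assms(1), of "\<lambda>I. lie_ideal I \<and> I \<noteq> {0}" L] assms(2)
      lie_idealD(1,2) by blast
  then show ?thesis unfolding minimal_ideal_def by metis
qed

lemma minimal_ideal_Int:
  assumes "minimal_ideal D" "minimal_ideal E" "D \<noteq> E"
  shows "D \<inter> E = {0}"
proof -
  have I: "lie_ideal (D \<inter> E)"
    using assms lie_ideal_Int by (simp add: minimal_ideal_def)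
  show ?thesis
  proof (rule ccontr)
    assume "D \<inter> E \<noteq> {0}"
    then have "D \<inter> E = D" "D \<inter> E = E"
      using assms(1,2) I unfolding minimal_ideal_def by (metis Int_lower1, metis Int_lower2)
    then show False using assms(3) by simp
  qed
qed

text \<open>The bracket lies in both ideals, and distinct minimal ideals meet in 0.\<close>

lemma minimal_ideal_br:
  assumes "minimal_ideal D" "minimal_ideal E" "D \<noteq> E" "x \<in> D" "y \<in> E"
  shows "br x y = 0"
proof -
  have D: "lie_ideal D" and E: "lie_ideal E" using assms by (auto simp: minimal_ideal_def)
  have "x \<in> L" "y \<in> L" using lie_idealD(2)[OF D] lie_idealD(2)[OF E] assms by auto
  then have "br x y \<in> D \<inter> E"
    using lie_idealD(3)[OF E] lie_idealD(4)[OF D] assms by blast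
  then show ?thesis using minimal_ideal_Int[OF assms(1-3)] by simp
qed

end

section \<open>Powers of c as automorphisms of L\<close>

context taft_module_lie_algebra
begin

lemma C_in_L [simp]: "x \<in> L \<Longrightarrow> C x \<in> L" and V_in_L [simp]: "x \<in> L \<Longrightarrow> V x \<in> L"
  by simp_all

text \<open>Scalars are central in the free algebra and act by \<open>scale\<close>.\<close>

lemma act_gen_scale:
  assumes "x \<in> L"
  shows "act (taft_class m \<zeta> (free_gen g)) (scale r x) = scale r (act (taft_class m \<zeta> (free_gen g)) x)"
proof -
  have "free_gen g * free_scalar r = free_scalar r * free_gen g"
    by (simp add: free_gen_def free_scalar_def mult_single)
  then have "act (taft_class m \<zeta> (free_gen g * free_scalar r)) x = act (taft_class m \<zeta> (free_scalar r * free_gen g)) x"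
    by simp
  then show ?thesis using assms by (simp only: act_class_mult act_scalar act_class_closed)
qed

lemma C_add: "x \<in> L \<Longrightarrow> y \<in> L \<Longrightarrow> C (x + y) = C x + C y"
  and V_add: "x \<in> L \<Longrightarrow> y \<in> L \<Longrightarrow> V (x + y) = V x + V y"
  by (simp_all add: act_add_right)

lemmas C_scale = act_gen_scale[of _ Gen_c] and V_scale = act_gen_scale[of _ Gen_v]

lemma C_zero [simp]: "C 0 = 0" and V_zero [simp]: "V 0 = 0"
  using C_scale[of 0 0] V_scale[of 0 0] by simp_all

text \<open>Any h acts as a linear combination of words in \<open>C\<close> and \<open>V\<close>, so
  stability under the generators is enough.\<close>

lemma taft_invariantI:
  assumes "subspace I" "I \<subseteq> L" "\<And>x. x \<in> I \<Longrightarrow> C x \<in> I" "\<And>x. x \<in> I \<Longrightarrow> V x \<in> I"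
  shows "taft_invariant I"
  unfolding taft_invariant_def
proof (intro ballI)
  fix h x assume h: "h \<in> carrier (taft_algebra m \<zeta>)" and x: "x \<in> I"
  have word: "word_act C V w x \<in> I" for w
  proof -
    have "foldr (gen_act C V) gs x \<in> I" for gs
    proof (induction gs)
      case (Cons g gs)
      then show ?case by (cases g) (simp_all add: assms(3,4))
    qed (simp add: x)
    then show ?thesis by (simp add: word_act_def)
  qed
  have "act h x = free_act scale C V (SOME f. f \<in> h) x"
    using act_class[of x "SOME f. f \<in> h"] assms(2) x by (auto simp: taft_class_some_eq[OF h])
  also have "\<dots> \<in> I"
    unfolding free_act_def by (intro subspace_sum subspace_scale assms(1) word)
  finally show "act h x \<in> I" .
qed

lemma Cn_closed [simp]: "x \<in> L \<Longrightarrow> (C ^^ n) x \<in> L"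
  by (induction n) simp_all

lemma Cn_add: "x \<in> L \<Longrightarrow> y \<in> L \<Longrightarrow> (C ^^ n) (x + y) = (C ^^ n) x + (C ^^ n) y"
  by (induction n) (simp_all add: C_add)

lemma Cn_scale: "x \<in> L \<Longrightarrow> (C ^^ n) (scale r x) = scale r ((C ^^ n) x)"
  by (induction n) (simp_all add: C_scale)

lemma Cn_br: "x \<in> L \<Longrightarrow> y \<in> L \<Longrightarrow> (C ^^ n) (br x y) = br ((C ^^ n) x) ((C ^^ n) y)"
  by (induction n) (simp_all add: C_br)

lemma Cn_m: "x \<in> L \<Longrightarrow> (C ^^ (m * n)) x = x"
  by (induction n) (simp_all add: funpow_add C_power)

text \<open>The exponent mn - n is a natural number congruent to -n modulo m, so it gives the
  inverse of c^n without negative powers.\<close>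

lemma Cn_inverse:
  assumes "x \<in> L"
  shows "(C ^^ n) ((C ^^ (m * n - n)) x) = x" "(C ^^ (m * n - n)) ((C ^^ n) x) = x"
proof -
  have "n \<le> m * n" using m_ge_2 by simp
  then have "n + (m * n - n) = m * n" "(m * n - n) + n = m * n" by simp_all
  then show "(C ^^ n) ((C ^^ (m * n - n)) x) = x" "(C ^^ (m * n - n)) ((C ^^ n) x) = x"
    using Cn_m[OF assms, of n] funpow_add[of n "m * n - n" C] funpow_add[of "m * n - n" n C]
    by (metis comp_apply)+
qed

lemma Cn_inj: "x \<in> L \<Longrightarrow> y \<in> L \<Longrightarrow> (C ^^ n) x = (C ^^ n) y \<Longrightarrow> x = y"
  using Cn_inverse(2) by metis

lemma Cn_eq_0_iff: "x \<in> L \<Longrightarrow> (C ^^ n) x = 0 \<longleftrightarrow> x = 0"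
  using Cn_inj[of x 0 n] Cn_scale[of 0 n 0] by auto

text \<open>Since c is an automorphism, [x, c^n y] = c^n [c^(-n) x, y].\<close>

lemma lie_ideal_Cn_image:
  assumes "lie_ideal I"
  shows "lie_ideal ((C ^^ n) ` I)"
proof -
  note I = lie_idealD[OF assms]
  have IL: "x \<in> L" if "x \<in> I" for x using that I(2) by blast
  have "br x ((C ^^ n) y) \<in> (C ^^ n) ` I" if "x \<in> L" "y \<in> I" for x y
  proof -
    have "br x ((C ^^ n) y) = (C ^^ n) (br ((C ^^ (m * n - n)) x) y)"
      using that IL by (simp add: Cn_br Cn_inverse)
    then show ?thesis using I(3)[of "(C ^^ (m * n - n)) x" y] that by simp
  qed
  moreover have "subspace ((C ^^ n) ` I)"
  proof (rule subspaceI)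
    show "0 \<in> (C ^^ n) ` I"
      using Cn_eq_0_iff[of 0 n] subspace_0[OF I(1)] by (simp add: image_iff) (metis)
    show "x + y \<in> (C ^^ n) ` I" if "x \<in> (C ^^ n) ` I" "y \<in> (C ^^ n) ` I" for x y
      using that I(1) IL by (auto simp flip: Cn_add simp: subspace_add)
    show "scale r x \<in> (C ^^ n) ` I" if "x \<in> (C ^^ n) ` I" for r x
      using that I(1) IL by (auto simp flip: Cn_scale simp: subspace_scale)
  qed
  ultimately show ?thesis
    unfolding lie_ideal_def using IL by auto
qed

lemma minimal_ideal_Cn_image:
  assumes "minimal_ideal D"
  shows "minimal_ideal ((C ^^ n) ` D)"
proof -
  have D: "lie_ideal D" "D \<noteq> {0}" "\<And>I. lie_ideal I \<Longrightarrow> I \<subseteq> D \<Longrightarrow> I = {0} \<or> I = D"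
    using assms by (auto simp: minimal_ideal_def)
  have DL: "x \<in> L" if "x \<in> D" for x using that lie_idealD(2)[OF D(1)] by blast
  have "(C ^^ n) ` D \<noteq> {0}"
  proof
    assume "(C ^^ n) ` D = {0}"
    then have "x = 0" if "x \<in> D" for x using that Cn_eq_0_iff[OF DL[OF that], of n] by blast
    then show False using D(2) subspace_0[OF lie_idealD(1)[OF D(1)]] by blast
  qed
  moreover have "I = {0} \<or> I = (C ^^ n) ` D" if I: "lie_ideal I" "I \<subseteq> (C ^^ n) ` D" for I
  proof -
    \<comment> \<open>\<open>?J\<close> is c^(-n) I, an ideal inside D. Minimality of D applies to
      it, and c^n carries the result back to I.\<close>
    let ?J = "(C ^^ (m * n - n)) ` I"
    have "?J \<subseteq> D" using I(2) DL by (auto simp: Cn_inverse(2) dest!: subsetD)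
    then have "?J = {0} \<or> ?J = D" by (intro D(3) lie_ideal_Cn_image I(1))
    moreover have "(C ^^ n) ` ?J = I"
      using lie_idealD(2)[OF I(1)] by (force simp: image_image Cn_inverse(1) subset_iff)
    ultimately show ?thesis
      using Cn_eq_0_iff[of 0 n] by auto
  qed
  ultimately show ?thesis
    unfolding minimal_ideal_def using lie_ideal_Cn_image[OF D(1)] by blast
qed

end


section \<open>Minimal ideals and the action of \<open>v\<close>\<close>

locale taft_semisimple = taft_module_lie_algebra scale L br m \<zeta> act
  for scale :: "'f::alg_closed_field \<Rightarrow> 'v::ab_group_add \<Rightarrow> 'v"
    and L :: "'v set" and br :: "'v \<Rightarrow> 'v \<Rightarrow> 'v" and m :: nat and \<zeta> :: 'f
    and act :: "'f free_alg set \<Rightarrow> 'v \<Rightarrow> 'v" +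
  assumes fin_dim: "fin_dim"
    and semisimple: "semisimple"
    and taft_simple: "taft_simple"
    and not_simple: "\<not> simple"
begin

text \<open>This removes v from the simplicity hypothesis; the absence of invariant ideals is used
  only in this form from here on.\<close>

lemma C_invariant_ideal:
  assumes I: "lie_ideal I" "\<And>x. x \<in> I \<Longrightarrow> C x \<in> I"
  shows "I = {0} \<or> I = L"
proof (rule disjCI)
  assume "I \<noteq> L"
  show "I = {0}"
  proof (rule ccontr)
    assume "I \<noteq> {0}"
    let ?P = "\<lambda>J. lie_ideal J \<and> J \<noteq> {0} \<and> (\<forall>x\<in>J. C x \<in> J)"
    have PI: "?P I" using I \<open>I \<noteq> {0}\<close> by simp
    have PL: "subspace J \<and> J \<subseteq> L" if "?P J" for J
      using that lie_idealD(1,2)[of J] by simp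
    obtain J where "?P J \<and> J \<subseteq> I \<and> (\<forall>J'. ?P J' \<and> J' \<subseteq> J \<longrightarrow> J' = J)"
      using finite_dimensional_minimal[of ?P I, OF fin_dim PI PL] ..
    then have J: "?P J" "J \<subseteq> I" and J_min: "\<And>J'. ?P J' \<Longrightarrow> J' \<subseteq> J \<Longrightarrow> J' = J"
      by blast+
    note JD = lie_idealD[OF conjunct1[OF J(1)]]
    have JL: "x \<in> L" if "x \<in> J" for x using that JD(2) by blast
    have "commutator J J \<subseteq> {y \<in> L. C y \<in> commutator J J}"
      unfolding commutator_def
    proof (rule span_minimal)
      have "C (br x y) \<in> span {br x y |x y. x \<in> J \<and> y \<in> J}" if "x \<in> J" "y \<in> J" for x y
        unfolding C_br[OF JL[OF that(1)] JL[OF that(2)]] using J(1) that by (intro span_base) blast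
      then show "{br x y |x y. x \<in> J \<and> y \<in> J} \<subseteq> {y \<in> L. C y \<in> span {br x y |x y. x \<in> J \<and> y \<in> J}}"
        using JL br_closed by blast
      show "subspace {y \<in> L. C y \<in> span {br x y |x y. x \<in> J \<and> y \<in> J}}"
        by (intro subspaceI) (auto simp: C_add C_scale span_add span_scale span_zero)
    qed
    \<comment> \<open>[J, J] is a c-stable ideal inside J, nonzero by semisimplicity, so minimality
      of J gives equality.\<close>
    then have perfect: "commutator J J = J"
      using J(1) by (intro J_min commutator_subset_ideal)
        (auto simp: lie_ideal_commutator semisimple_commutator_ne_zero[OF semisimple])
    have "commutator J J \<subseteq> {y \<in> L. V y \<in> J}"
      unfolding commutator_def
    proof (rule span_minimal)
      \<comment> \<open>In [cx, vy] + [vx, y] the entries cx and y lie in J, so both brackets do,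
        wherever vx and vy lie in L.\<close>
      have "V (br x y) \<in> J" if "x \<in> J" "y \<in> J" for x y
        using that J(1) JL JD(3)[of "V x" y] JD(4)[of "V y" "C x"]
        by (simp add: V_br subspace_add[OF JD(1)])
      then show "{br x y |x y. x \<in> J \<and> y \<in> J} \<subseteq> {y \<in> L. V y \<in> J}"
        using JL by (auto simp: br_closed)
      show "subspace {y \<in> L. V y \<in> J}"
        by (intro subspaceI)
          (auto simp: V_add V_scale subspace_add[OF JD(1)] subspace_scale[OF JD(1)] subspace_0[OF JD(1)])
    qed
    then have "taft_invariant J"
      using perfect J(1) JD(1,2) by (intro taft_invariantI) auto
    then have "J = L" using taft_simple J(1) unfolding taft_simple_def by blast
    then show False using J(2) lie_idealD(2)[OF I(1)] \<open>I \<noteq> L\<close> by blast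
  qed
qed

text \<open>The components are eigenspaces of c, so c multiplies each homogeneous part by a scalar
  and a homogeneous ideal is c-stable.\<close>

lemma graded_simple: "graded_simple"
  unfolding graded_simple_def
proof (intro conjI allI impI)
  show "commutator L L \<noteq> {0}" using taft_simple by (simp add: taft_simple_def)
next
  fix I assume I: "lie_ideal I \<and> homogeneous I"
  note ID = lie_idealD[OF conjunct1[OF I]]
  have "C x \<in> I" if x: "x \<in> I" for x
  proof -
    obtain d where d: "\<And>i. i < m \<Longrightarrow> d i \<in> I \<inter> component i" "x = (\<Sum>i<m. d i)"
      using I x unfolding homogeneous_def by blast
    have dL: "d i \<in> L" "C (d i) = scale (\<zeta> ^ i) (d i)" "d i \<in> I" if "i < m" for i
      using d(1)[OF that] by (auto simp: component_def)
    have "C (\<Sum>i<n. d i) \<in> I" if "n \<le> m" for n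
      using that
    proof (induction n)
      case 0
      show ?case using subspace_0[OF ID(1)] by simp
    next
      case (Suc n)
      have "(\<Sum>i<n. d i) \<in> L" using dL Suc.prems by (intro sum_in_L) simp
      then have "C (\<Sum>i<Suc n. d i) = C (\<Sum>i<n. d i) + scale (\<zeta> ^ n) (d n)"
        using dL[of n] Suc.prems by (simp add: C_add)
      then show ?case
        using Suc dL[of n] by (simp add: subspace_add[OF ID(1)] subspace_scale[OF ID(1)])
    qed
    then show ?thesis using d(2) by simp
  qed
  then show "I = {0} \<or> I = L" using I C_invariant_ideal by blast
qed

lemma L_ne_zero: "L \<noteq> {0}"
  using taft_simple by (auto simp: taft_simple_def commutator_ne_zero_iff)

section \<open>The c-orbit of a minimal ideal\<close>

definition B :: "'v set"
  where "B = (SOME D. minimal_ideal D)"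

text \<open>Indices run over all natural numbers and may repeat an ideal. Distinctness below m comes
  later, from a nonzero action of v.\<close>

definition orb :: "nat \<Rightarrow> 'v set"
  where "orb i = (C ^^ i) ` B"

lemma minimal_ideal_orb: "minimal_ideal (orb i)"
proof -
  have "minimal_ideal B"
    unfolding B_def using minimal_ideal_exists[OF fin_dim L_ne_zero] by (rule someI_ex)
  then show ?thesis unfolding orb_def by (rule minimal_ideal_Cn_image)
qed

lemma orb_0: "orb 0 = B" and orb_Suc: "orb (Suc i) = C ` orb i"
  by (simp_all add: orb_def image_image)

lemma lie_ideal_orb: "lie_ideal (orb i)"
  using minimal_ideal_orb by (simp add: minimal_ideal_def)

lemmas orbD = lie_idealD[OF lie_ideal_orb]

lemma orb_L: "x \<in> orb i \<Longrightarrow> x \<in> L"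
  using orbD(2) by blast

lemma C_orb: "x \<in> orb i \<Longrightarrow> C x \<in> orb (Suc i)"
  by (simp add: orb_Suc)

lemma orb_m: "orb (i + m) = orb i"
  using orbD(2)[of 0]
  by (auto simp: orb_def funpow_add C_power image_iff subset_iff intro!: bexI)

text \<open>The span of all \<open>orb i\<close> is a nonzero c-stable ideal, hence L. In this form
  it reduces a linear condition on L to the orbit members.\<close>

lemma orb_span:
  assumes S: "subspace S" "\<And>i x. x \<in> orb i \<Longrightarrow> x \<in> S" and "x \<in> L"
  shows "x \<in> S"
proof -
  let ?U = "\<Union>i. orb i"
  have UL: "span ?U \<subseteq> L"
    using orb_L by (intro span_minimal subspace_carrier) auto
  have "span ?U \<subseteq> {y \<in> L. br x y \<in> span ?U}" if "x \<in> L" for x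
  proof (rule span_minimal)
    show "?U \<subseteq> {y \<in> L. br x y \<in> span ?U}"
      using that orbD(3) orb_L by (auto intro!: span_base)
    show "subspace {y \<in> L. br x y \<in> span ?U}"
      using that by (intro subspaceI) (auto simp: br_add_right br_scale_right span_add span_scale span_zero)
  qed
  then have "lie_ideal (span ?U)"
    unfolding lie_ideal_def using UL by auto
  moreover have "span ?U \<subseteq> {y \<in> L. C y \<in> span ?U}"
  proof (rule span_minimal)
    show "?U \<subseteq> {y \<in> L. C y \<in> span ?U}"
      using C_orb orb_L by (auto intro!: span_base)
    show "subspace {y \<in> L. C y \<in> span ?U}"
      by (intro subspaceI) (auto simp: C_add C_scale span_add span_scale span_zero)
  qed
  ultimately have "span ?U = {0} \<or> span ?U = L"
    by (intro C_invariant_ideal) auto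
  moreover have "span ?U \<noteq> {0}"
  proof
    assume "span ?U = {0}"
    then have "orb 0 \<subseteq> {0}" using span_superset[of ?U] by blast
    then have "orb 0 = {0}" using subspace_0[OF orbD(1)] by blast
    then show False using minimal_ideal_orb[of 0] by (simp add: minimal_ideal_def)
  qed
  ultimately have "span ?U = L" by blast
  moreover have "span ?U \<subseteq> S" using S by (intro span_minimal) auto
  ultimately show ?thesis using assms(3) by blast
qed

lemma orb_centralizer:
  assumes z: "z \<in> L" "\<And>i x. x \<in> orb i \<Longrightarrow> br z x = 0"
  shows "z = 0"
proof (rule semisimple_centre_zero[OF semisimple z(1)])
  have "subspace {x \<in> L. br z x = 0}"
    using z(1) by (intro subspaceI) (auto simp: br_add_right br_scale_right)
  then show "br z x = 0" if "x \<in> L" for x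
    using orb_span[of "{x \<in> L. br z x = 0}" x] that z(2) orb_L by blast
qed

text \<open>An ideal I of D is an ideal of L: orbit members equal to D preserve I, and all others
  commute with D.\<close>

lemma simple_minimal_ideal:
  assumes "minimal_ideal D"
  shows "lie_algebra.simple scale D br"
proof -
  have D: "lie_ideal D" "D \<noteq> {0}" "\<And>I. lie_ideal I \<Longrightarrow> I \<subseteq> D \<Longrightarrow> I = {0} \<or> I = D"
    using assms by (auto simp: minimal_ideal_def)
  interpret D: lie_algebra scale D br using lie_algebra_lie_ideal D(1) .
  have "I = {0} \<or> I = D" if "D.lie_ideal I" for I
  proof -
    have I: "subspace I" "I \<subseteq> D" "\<And>x y. x \<in> D \<Longrightarrow> y \<in> I \<Longrightarrow> br x y \<in> I"
      using that by (auto simp: D.lie_ideal_def)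
    have IL: "y \<in> L" if "y \<in> I" for y using that I(2) lie_idealD(2)[OF D(1)] by blast
    have "br x y \<in> I" if "x \<in> L" "y \<in> I" for x y
    proof -
      have "subspace {x \<in> L. br x y \<in> I}"
        using that IL I(1) by (intro subspaceI)
          (auto simp: br_add_left br_scale_left subspace_0 subspace_add subspace_scale)
      moreover have "br x y \<in> I" if "x \<in> orb i" for i x
      proof (cases "orb i = D")
        case True
        then show ?thesis using that I(3) \<open>y \<in> I\<close> by blast
      next
        case False
        then have "br x y = 0"
          using minimal_ideal_br[OF minimal_ideal_orb assms] that I(2) \<open>y \<in> I\<close> by blast
        then show ?thesis using subspace_0[OF I(1)] by simp
      qed
      ultimately show ?thesis
        using orb_span[of "{x \<in> L. br x y \<in> I}" x] that(1) orb_L by blast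
    qed
    then have "lie_ideal I" using I IL unfolding lie_ideal_def by blast
    then show ?thesis using D(3) I(2) by blast
  qed
  moreover have "D.commutator D D \<noteq> {0}"
    using semisimple_commutator_ne_zero[OF semisimple D(1,2)] .
  ultimately show ?thesis unfolding D.simple_def by blast
qed

text \<open>Otherwise \<open>orb i\<close> is c-stable, hence all of L, and L would be
  simple.\<close>

lemma orb_Suc_ne: "orb (Suc i) \<noteq> orb i"
proof
  assume eq: "orb (Suc i) = orb i"
  have "C x \<in> orb i" if "x \<in> orb i" for x
    using C_orb[OF that] eq by simp
  then have "orb i = L"
    using C_invariant_ideal[OF lie_ideal_orb] minimal_ideal_orb[of i]
    unfolding minimal_ideal_def by blast
  then show False using simple_minimal_ideal[OF minimal_ideal_orb[of i]] not_simple by simp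
qed

section \<open>The action of v on the orbit\<close>

lemma orb_br_ne_zero: "\<exists>x\<in>orb i. \<exists>y\<in>orb i. br x y \<noteq> 0"
  using semisimple_commutator_ne_zero[OF semisimple lie_ideal_orb] minimal_ideal_orb[of i]
  by (simp add: minimal_ideal_def commutator_ne_zero_iff)

lemma br_orb: "orb i \<noteq> orb j \<Longrightarrow> x \<in> orb i \<Longrightarrow> y \<in> orb j \<Longrightarrow> br x y = 0"
  using minimal_ideal_br[OF minimal_ideal_orb minimal_ideal_orb] .

lemma orb_disjoint: "orb i \<noteq> orb j \<Longrightarrow> x \<in> orb i \<Longrightarrow> x \<in> orb j \<Longrightarrow> x = 0"
  using minimal_ideal_Int[OF minimal_ideal_orb minimal_ideal_orb, of i j] by blast

text \<open>Write vd = p + q + r with r in the span of the remaining orbit members. Then r commutes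
  with every orbit member and so is 0.\<close>

lemma V_orb:
  assumes d: "d \<in> orb i"
  shows "\<exists>p\<in>orb i. \<exists>q\<in>orb (Suc i). V d = p + q"
proof -
  let ?D = "orb i" and ?E = "orb (Suc i)"
  let ?K = "span (\<Union>j\<in>{j. orb j \<noteq> ?D \<and> orb j \<noteq> ?E}. orb j)"
  let ?S = "{x + y |x y. x \<in> {x + y |x y. x \<in> ?D \<and> y \<in> ?E} \<and> y \<in> ?K}"
  have dL: "d \<in> L" using d orb_L by blast
  have zero: "0 \<in> ?D" "0 \<in> ?E" "0 \<in> ?K" using subspace_0[OF orbD(1)] span_zero by blast+
  have "subspace ?S" by (intro subspace_sums orbD(1) subspace_span)
  moreover have "x \<in> ?S" if x: "x \<in> orb j" for j x
  proof -
    consider "orb j = ?D" | "orb j = ?E" | "orb j \<noteq> ?D" "orb j \<noteq> ?E" by blast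
    then obtain p q r where "p \<in> ?D" "q \<in> ?E" "r \<in> ?K" "x = p + q + r"
    proof cases
      case 1
      then show ?thesis using that[of x 0 0] x zero by simp
    next
      case 2
      then show ?thesis using that[of 0 x 0] x zero by simp
    next
      case 3
      then have "x \<in> ?K" using x by (intro span_base) blast
      then show ?thesis using that[of 0 0 x] zero by simp
    qed
    then show ?thesis by blast
  qed
  ultimately have "V d \<in> ?S" using dL by (intro orb_span[of ?S "V d"]) auto
  then obtain p q r where pqr: "p \<in> ?D" "q \<in> ?E" "r \<in> ?K" "V d = p + q + r" by blast
  have pqL: "p \<in> L" "q \<in> L" using pqr orb_L by blast+
  have KL: "?K \<subseteq> L" using orb_L by (intro span_minimal subspace_carrier) auto
  then have rL: "r \<in> L" using pqr(3) by blast
  have K: "br r x = 0" if x: "x \<in> ?D \<or> x \<in> ?E" for x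
  proof -
    have xL: "x \<in> L" using x orb_L by blast
    then have "subspace {y \<in> L. br y x = 0}"
      by (intro subspaceI) (auto simp: br_add_left br_scale_left)
    moreover have "(\<Union>j\<in>{j. orb j \<noteq> ?D \<and> orb j \<noteq> ?E}. orb j) \<subseteq> {y \<in> L. br y x = 0}"
      using x br_orb orb_L by blast
    ultimately have "?K \<subseteq> {y \<in> L. br y x = 0}" using span_minimal by blast
    then show ?thesis using pqr(3) by blast
  qed
  have "br r x = 0" if x: "x \<in> orb j" for j x
  proof (cases "orb j = ?D \<or> orb j = ?E")
    case True
    then show ?thesis using x K by blast
  next
    case False
    have xL: "x \<in> L" using x orb_L by blast
    \<comment> \<open>Here a = c^(-1) x lies in the member preceding \<open>orb j\<close>. That
      member is not \<open>orb i\<close>, because \<open>orb j\<close> is not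
      \<open>orb (Suc i)\<close>; hence [a, d] = 0.\<close>
    define a where "a = (C ^^ (m - 1)) x"
    have aL: "a \<in> L" using xL by (simp add: a_def)
    have m: "Suc (m - 1) = m" using m_ge_2 by simp
    have Ca: "C a = x"
      using C_power[OF xL] funpow.simps(2)[of "m - 1" C] unfolding m a_def by (metis comp_apply)
    have a: "a \<in> orb (j + (m - 1))"
      using x by (auto simp: a_def orb_def funpow_add add.commute[of j])
    have "orb (j + (m - 1)) \<noteq> ?D"
    proof
      assume "orb (j + (m - 1)) = ?D"
      then have "orb (Suc (j + (m - 1))) = ?E" by (simp add: orb_Suc)
      moreover have "Suc (j + (m - 1)) = j + m" using m_ge_2 by simp
      ultimately show False using orb_m False by simp
    qed
    then have "br a d = 0" using br_orb a d by blast
    \<comment> \<open>Apply v to [a, d] = 0. Then [x, vd] = [-va, d] lies in both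
      \<open>orb j\<close> and \<open>orb i\<close>, so it is 0.\<close>
    then have "br x (V d) + br (V a) d = 0"
      using V_br[OF aL dL] Ca by simp
    then have "br x (V d) = br (- V a) d"
      using aL dL by (simp add: br_neg_left eq_neg_iff_add_eq_0)
    moreover have "br (- V a) d \<in> ?D" using aL d by (intro orbD(3)) auto
    moreover have "br x (V d) \<in> orb j" using dL x by (intro orbD(4)) auto
    ultimately have "br x (V d) = 0" using orb_disjoint[of j i] False by auto
    then have "br (V d) x = 0" using br_anticomm[of "V d" x] dL xL by simp
    moreover have "br p x = 0" "br q x = 0" using br_orb False pqr x by blast+
    ultimately show ?thesis
      unfolding pqr(4) using pqL rL xL by (simp add: br_add_left)
  qed
  then have "r = 0" using orb_centralizer[OF rL] by blast
  then show ?thesis using pqr by auto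
qed

text \<open>The components f and cg of v are well defined and linear because \<open>orb i\<close>
  and \<open>orb (Suc i)\<close> meet in 0. Both f and g lie in the centroid of
  \<open>orb i\<close>.\<close>

lemma V_orb_scalars: "\<exists>r s. \<forall>d\<in>orb i. V d = scale r d + scale s (C d)"
proof -
  let ?D = "orb i"
  have DL: "x \<in> L" if "x \<in> ?D" for x using that orb_L by blast
  have "\<forall>d\<in>?D. \<exists>pq. fst pq \<in> ?D \<and> snd pq \<in> ?D \<and> V d = fst pq + C (snd pq)"
    using V_orb[of _ i] by (fastforce simp: orb_Suc)
  then obtain h where h: "\<And>d. d \<in> ?D \<Longrightarrow> fst (h d) \<in> ?D \<and> snd (h d) \<in> ?D \<and> V d = fst (h d) + C (snd (h d))"
    by metis
  define f where "f d = fst (h d)" for d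
  define g where "g d = snd (h d)" for d
  have fg: "f d \<in> ?D" "g d \<in> ?D" "V d = f d + C (g d)" if "d \<in> ?D" for d
    using h[OF that] by (simp_all add: f_def g_def)
  have uniq: "f d = p \<and> g d = q" if "d \<in> ?D" "p \<in> ?D" "q \<in> ?D" "V d = p + C q" for d p q
  proof -
    have "f d - p = C (q - g d)"
      using that fg(3)[OF that(1)] fg(2)[OF that(1)] C_add[of "q - g d" "g d"] DL
      by (simp add: algebra_simps)
    moreover have "f d - p \<in> ?D" using fg(1) that by (simp add: subspace_diff[OF orbD(1)])
    moreover have "q - g d \<in> ?D" using fg(2) that by (simp add: subspace_diff[OF orbD(1)])
    ultimately have "f d - p = 0" "C (q - g d) = 0"
      using orb_disjoint[of "Suc i" i "f d - p"] C_orb[of "q - g d" i] orb_Suc_ne[of i] by simp_all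
    moreover have "q - g d \<in> L" using \<open>q - g d \<in> ?D\<close> DL by blast
    ultimately show ?thesis using Cn_eq_0_iff[of "q - g d" 1] by simp
  qed
  have add: "f (x + y) = f x + f y \<and> g (x + y) = g x + g y" if "x \<in> ?D" "y \<in> ?D" for x y
    using that fg[OF that(1)] fg[OF that(2)] DL
    by (intro uniq) (simp_all add: subspace_add[OF orbD(1)] V_add C_add)
  have sc: "f (scale r x) = scale r (f x) \<and> g (scale r x) = scale r (g x)" if "x \<in> ?D" for r x
    using that fg[OF that(1)] DL
    by (intro uniq) (simp_all add: subspace_scale[OF orbD(1)] V_scale C_scale scale_right_distrib)
  have brD: "br x y \<in> ?D" if "x \<in> ?D" "y \<in> ?D" for x y
    using that orbD(3) DL by blast
  \<comment> \<open>Expanding v[x, y], the mixed terms [cx, fy] and [c(gx), y] pair different orbit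
    members and vanish; \<open>uniq\<close> then separates the components.\<close>
  have br: "f (br x y) = br (f x) y \<and> g (br x y) = br x (g y)" if xy: "x \<in> ?D" "y \<in> ?D" for x y
  proof (rule uniq)
    note fx = fg[OF xy(1)] and fy = fg[OF xy(2)]
    have "br (C x) (f y) = 0" "br (C (g x)) y = 0"
      using br_orb[OF orb_Suc_ne] C_orb xy fx(2) fy(1) by blast+
    then show "V (br x y) = br (f x) y + C (br x (g y))"
      using xy fx fy DL by (simp add: V_br br_add_left br_add_right C_br)
  qed (use xy fg brD in auto)
  \<comment> \<open>\<open>centroid_scalar\<close> wants f on the second entry, whereas
    \<open>br\<close> puts it on the first.\<close>
  have br': "f (br x y) = br x (f y)" if xy: "x \<in> ?D" "y \<in> ?D" for x y
  proof -
    have "br x y = scale (-1) (br y x)" "br x (f y) = - br (f y) x"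
      using br_anticomm[of x y] br_anticomm[of x "f y"] xy DL fg(1) by simp_all
    then show ?thesis using sc[OF brD[OF xy(2,1)], of "-1"] br[OF xy(2,1)] by simp
  qed
  obtain T where T: "finite T" "?D \<subseteq> span T"
    using fin_dim orbD(2) by (auto simp: fin_dim_def)
  note D = lie_algebra_lie_ideal[OF lie_ideal_orb] simple_minimal_ideal[OF minimal_ideal_orb]
  obtain r where "\<forall>x\<in>?D. f x = scale r x"
    using centroid_scalar[OF D T, of f] fg(1) add sc br' by blast
  moreover obtain s where "\<forall>x\<in>?D. g x = scale s x"
    using centroid_scalar[OF D T, of g] fg(2) add sc br by blast
  ultimately have "V d = scale r d + scale s (C d)" if "d \<in> ?D" for d
    using fg(3)[OF that] DL[OF that] that by (simp add: C_scale)
  then show ?thesis by blast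
qed

text \<open>The constant \<alpha> is \<open>r 0\<close>. A vanishing bracket gives s i = -r (i+1),
  and vc = \<zeta>cv gives r (i+1) = \<zeta> r i.\<close>

lemma V_orb_explicit:
  "\<exists>\<alpha>. \<forall>i. \<forall>d\<in>orb i. V d = scale (\<alpha> * \<zeta> ^ i) d - scale (\<alpha> * \<zeta> ^ Suc i) (C d)"
proof -
  obtain r s where V: "\<And>i d. d \<in> orb i \<Longrightarrow> V d = scale (r i) d + scale (s i) (C d)"
    using V_orb_scalars by metis
  have s: "s i = - r (Suc i)" for i
  proof -
    obtain x y where xy: "x \<in> orb i" "y \<in> orb i" "br x y \<noteq> 0" using orb_br_ne_zero by blast
    have L: "x \<in> L" "y \<in> L" using xy orb_L by blast+
    have Cy: "C x \<in> orb (Suc i)" "C y \<in> orb (Suc i)" "C (C y) \<in> orb (Suc (Suc i))"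
      using xy by (simp_all add: C_orb)
    have z: "br x (C y) = 0" "br (C x) (C (C y)) = 0"
      using br_orb[OF not_sym[OF orb_Suc_ne]] xy(1) Cy by blast+
    \<comment> \<open>Apply v to [x, cy] = 0: only multiples of [cx, cy] = c[x, y] survive, and this
      is nonzero by injectivity of c.\<close>
    have "0 = V (br x (C y))" by (simp add: z)
    also have "\<dots> = br (C x) (scale (r (Suc i)) (C y) + scale (s (Suc i)) (C (C y))) +
        br (scale (r i) x + scale (s i) (C x)) (C y)"
      by (simp only: V_br[OF L(1) C_in_L[OF L(2)]] V[OF Cy(2)] V[OF xy(1)])
    also have "\<dots> = scale (r (Suc i) + s i) (br (C x) (C y))"
      using L by (simp add: br_add_left br_add_right br_scale_left br_scale_right z scale_left_distrib)
    finally have "r (Suc i) + s i = 0 \<or> br (C x) (C y) = 0" by simp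
    moreover have "br (C x) (C y) \<noteq> 0"
      using xy(3) Cn_eq_0_iff[of "br x y" 1] L by (simp add: C_br br_closed)
    ultimately show ?thesis by (simp add: eq_neg_iff_add_eq_0 add.commute)
  qed
  have r: "r (Suc i) = \<zeta> * r i" for i
  proof -
    obtain d where d: "d \<in> orb i" "d \<noteq> 0"
      using minimal_ideal_orb[of i] subspace_0[OF orbD(1)] unfolding minimal_ideal_def by blast
    have L: "d \<in> L" using d orb_L by blast
    have Cd: "C d \<in> orb (Suc i)" "C (C d) \<in> orb (Suc (Suc i))" using d by (simp_all add: C_orb)
    have "scale (r (Suc i)) (C d) + scale (s (Suc i)) (C (C d)) =
        scale (\<zeta> * r i) (C d) + scale (\<zeta> * s i) (C (C d))"
      using V_C[OF L] L by (simp add: V[OF Cd(1)] V[OF d(1)] C_add C_scale scale_right_distrib)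
    then have eq: "scale (r (Suc i) - \<zeta> * r i) (C d) = scale (\<zeta> * s i - s (Suc i)) (C (C d))"
      by (simp add: scale_left_diff_distrib algebra_simps)
    \<comment> \<open>The two sides of \<open>eq\<close> lie in \<open>orb (Suc i)\<close> and
      \<open>orb (Suc (Suc i))\<close>, which meet in 0.\<close>
    have "scale (r (Suc i) - \<zeta> * r i) (C d) = 0"
      using orb_disjoint[OF orb_Suc_ne] eq Cd subspace_scale[OF orbD(1)] by metis
    moreover have "C d \<noteq> 0" using d(2) Cn_eq_0_iff[OF L, of 1] by simp
    ultimately show ?thesis by simp
  qed
  have r0: "r i = r 0 * \<zeta> ^ i" for i
    by (induction i) (simp_all add: r)
  have "V d = scale (r 0 * \<zeta> ^ i) d - scale (r 0 * \<zeta> ^ Suc i) (C d)" if "d \<in> orb i" for i d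
    using V[OF that] s[of i] by (simp only: r0[of i] r0[of "Suc i"]) simp
  then show ?thesis by blast
qed

text \<open>If \<open>orb i = orb j\<close>, the two formulas for v put \<alpha>(\<zeta>^i -
  \<zeta>^j) d into \<open>orb i\<close> and \<open>orb (Suc i)\<close> at once, so it is 0, and
  primitivity of \<zeta> excludes this.\<close>

lemma orb_distinct:
  assumes V: "\<And>i d. d \<in> orb i \<Longrightarrow> V d = scale (\<alpha> * \<zeta> ^ i) d - scale (\<alpha> * \<zeta> ^ Suc i) (C d)"
    and "V ` L \<noteq> {0}"
  shows "inj_on orb {..<m}"
proof -
  \<comment> \<open>For \<alpha> = 0 the formula makes v vanish on every orbit member, hence on
    L.\<close>
  have \<alpha>: "\<alpha> \<noteq> 0"
  proof
    assume "\<alpha> = 0"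
    then have "V d = 0" if "d \<in> orb i" for i d using V[OF that] by simp
    moreover have "subspace {x \<in> L. V x = 0}"
      by (intro subspaceI) (auto simp: V_add V_scale)
    ultimately have "V x = 0" if "x \<in> L" for x
      using orb_span[of "{x \<in> L. V x = 0}" x] that orb_L by blast
    then have "V ` L = {0}" using zero_in_L by (force simp del: zero_in_L)
    then show False using assms(2) by blast
  qed
  have "orb i \<noteq> orb j" if ij: "i < j" "j < m" for i j
  proof
    assume eq: "orb i = orb j"
    obtain d where d: "d \<in> orb i" "d \<noteq> 0"
      using minimal_ideal_orb[of i] subspace_0[OF orbD(1)] unfolding minimal_ideal_def by blast
    have d': "d \<in> orb j" using d eq by simp
    have "scale (\<alpha> * \<zeta> ^ i - \<alpha> * \<zeta> ^ j) d = scale (\<alpha> * \<zeta> ^ Suc i - \<alpha> * \<zeta> ^ Suc j) (C d)"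
      using V[OF d(1)] V[OF d'] by (simp add: scale_left_diff_distrib algebra_simps)
    then have "scale (\<alpha> * \<zeta> ^ i - \<alpha> * \<zeta> ^ j) d = 0"
      using orb_disjoint[OF orb_Suc_ne] subspace_scale[OF orbD(1)] d(1) C_orb[OF d(1)] by metis
    then have "\<zeta> ^ i = \<zeta> ^ j" using d(2) \<alpha> by simp
    also have "\<zeta> ^ j = \<zeta> ^ i * \<zeta> ^ (j - i)" using ij by (simp flip: power_add)
    finally have "\<zeta> ^ i * (1 - \<zeta> ^ (j - i)) = 0" by (simp add: algebra_simps)
    moreover have "\<zeta> \<noteq> 0" using primitive m_ge_2 by (auto simp: primitive_root_of_unity_def power_0_left)
    ultimately show False
      using primitive ij unfolding primitive_root_of_unity_def by auto
  qed
  then show ?thesis by (intro inj_onI) (metis lessThan_iff linorder_neqE_nat)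
qed

end


section \<open>The isomorphism with the copies\<close>

lemma vector_space_copies_scale: "vector_space scale \<Longrightarrow> vector_space (copies_scale scale)"
  by (simp add: vector_space_def copies_scale_def fun_eq_iff)

text \<open>
  The module axioms for \<open>taft_act\<close> on \<open>L'\<close>, including independence of the chosen representative, are
  inherited from \<open>L\<close> through \<open>\<psi>\<close>; they need not be checked for \<open>C'\<close> and \<open>V'\<close> directly.
\<close>

lemma taft_lie_isomorphic_transport:
  assumes "taft_module_lie_algebra scale L br m \<zeta> act"
    and "vector_space scale'"
    and sub': "module.subspace scale' L'"
    and br'_closed: "\<And>x y. x \<in> L' \<Longrightarrow> y \<in> L' \<Longrightarrow> br' x y \<in> L'"
    and C'_closed: "\<And>x. x \<in> L' \<Longrightarrow> C' x \<in> L'"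
    and V'_closed: "\<And>x. x \<in> L' \<Longrightarrow> V' x \<in> L'"
    and bij: "bij_betw \<psi> L' L"
    and add: "\<And>x y. x \<in> L' \<Longrightarrow> y \<in> L' \<Longrightarrow> \<psi> (x + y) = \<psi> x + \<psi> y"
    and sc: "\<And>r x. x \<in> L' \<Longrightarrow> \<psi> (scale' r x) = scale r (\<psi> x)"
    and br: "\<And>x y. x \<in> L' \<Longrightarrow> y \<in> L' \<Longrightarrow> \<psi> (br' x y) = br (\<psi> x) (\<psi> y)"
    and C: "\<And>x. x \<in> L' \<Longrightarrow> \<psi> (C' x) = act (taft_c m \<zeta>) (\<psi> x)"
    and V: "\<And>x. x \<in> L' \<Longrightarrow> \<psi> (V' x) = act (taft_v m \<zeta>) (\<psi> x)"
  shows "taft_lie_isomorphic m \<zeta> scale L br act scale' L' br' (taft_act scale' C' V')"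
proof -
  interpret taft_module_lie_algebra scale L br m \<zeta> act by fact
  interpret V': vector_space scale' by fact
  let ?act = "taft_act scale' C' V'"
  have \<psi>L: "\<psi> x \<in> L" if "x \<in> L'" for x using bij that by (auto simp: bij_betw_def)
  have inj: "x = y" if "x \<in> L'" "y \<in> L'" "\<psi> x = \<psi> y" for x y
    using bij that by (auto simp: bij_betw_def inj_on_def)
  have add': "x + y \<in> L'" if "x \<in> L'" "y \<in> L'" for x y using that V'.subspace_add[OF sub'] by blast
  have sc': "scale' r x \<in> L'" if "x \<in> L'" for r x using that V'.subspace_scale[OF sub'] by blast
  have zero': "0 \<in> L'" using V'.subspace_0[OF sub'] .
  have \<psi>0: "\<psi> 0 = 0" using sc[OF zero', of 0] by simp
  have sum': "(\<Sum>i\<in>A. f i) \<in> L'" "\<psi> (\<Sum>i\<in>A. f i) = (\<Sum>i\<in>A. \<psi> (f i))"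
    if "\<And>i. i \<in> A \<Longrightarrow> f i \<in> L'" for f :: "'x \<Rightarrow> _" and A
  proof -
    show "(\<Sum>i\<in>A. f i) \<in> L'" using that V'.subspace_sum[OF sub'] by blast
    show "\<psi> (\<Sum>i\<in>A. f i) = (\<Sum>i\<in>A. \<psi> (f i))"
      using that
    proof (induction A rule: infinite_finite_induct)
      case (insert i A)
      have "\<psi> (\<Sum>i\<in>A. f i) = (\<Sum>i\<in>A. \<psi> (f i))"
        by (rule insert.IH) (rule insert.prems, simp)
      moreover have "(\<Sum>i\<in>A. f i) \<in> L'"
        by (rule V'.subspace_sum[OF sub']) (rule insert.prems, simp)
      moreover have "f i \<in> L'" by (rule insert.prems) simp
      ultimately show ?case using insert.hyps by (simp add: add)
    qed (simp_all add: \<psi>0)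
  qed
  have word: "word_act C' V' w x \<in> L' \<and> \<psi> (word_act C' V' w x) = word_act C V w (\<psi> x)" if x: "x \<in> L'" for w x
  proof -
    have "foldr (gen_act C' V') gs x \<in> L' \<and>
        \<psi> (foldr (gen_act C' V') gs x) = foldr (gen_act C V) gs (\<psi> x)" for gs
    proof (induction gs)
      case (Cons g gs)
      then show ?case by (cases g) (simp_all add: C'_closed V'_closed C V)
    qed (simp add: x)
    then show ?thesis by (simp add: word_act_def)
  qed
  have act: "?act h x \<in> L'" "\<psi> (?act h x) = act h (\<psi> x)"
    if h: "h \<in> carrier (taft_algebra m \<zeta>)" and x: "x \<in> L'" for h x
  proof -
    let ?f = "SOME f. f \<in> h"
    show "?act h x \<in> L'"
      unfolding taft_act_def free_act_def by (intro sum' sc') (simp add: word x)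
    have "\<psi> (?act h x) = free_act scale C V ?f (\<psi> x)"
      unfolding taft_act_def free_act_def by (subst sum') (simp_all add: word sc sc' x)
    then show "\<psi> (?act h x) = act h (\<psi> x)"
      using act_class[OF \<psi>L[OF x], of ?f] by (simp add: taft_class_some_eq[OF h])
  qed
  \<comment> \<open>Each identity is checked after applying the injective map
    \<open>\<psi>\<close>.\<close>
  have lie: "lie_algebra scale' L' br'"
  proof unfold_locales
    show "br' (x + y) z = br' x z + br' y z" if "x \<in> L'" "y \<in> L'" "z \<in> L'" for x y z
      using that by (intro inj) (simp_all add: add' br'_closed add br \<psi>L br_add_left)
    show "br' x (y + z) = br' x y + br' x z" if "x \<in> L'" "y \<in> L'" "z \<in> L'" for x y z
      using that by (intro inj) (simp_all add: add' br'_closed add br \<psi>L br_add_right)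
    show "br' (scale' r x) y = scale' r (br' x y)" if "x \<in> L'" "y \<in> L'" for r x y
      using that by (intro inj) (simp_all add: sc' br'_closed sc br \<psi>L br_scale_left)
    show "br' x (scale' r y) = scale' r (br' x y)" if "x \<in> L'" "y \<in> L'" for r x y
      using that by (intro inj) (simp_all add: sc' br'_closed sc br \<psi>L br_scale_right)
    show "br' x x = 0" if "x \<in> L'" for x
      using that by (intro inj) (simp_all add: br'_closed br \<psi>L br_self \<psi>0 zero')
    show "br' x (br' y z) + br' y (br' z x) + br' z (br' x y) = 0"
      if "x \<in> L'" "y \<in> L'" "z \<in> L'" for x y z
      using that by (intro inj) (simp_all add: add' br'_closed add br \<psi>L jacobi \<psi>0 zero')
  qed (use sub' br'_closed in auto)
  interpret L': lie_algebra scale' L' br' by (rule lie)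
  \<comment> \<open>Sums and products of classes stay in the carrier, so \<open>act\<close> applies
    to them.\<close>
  interpret R: ring "taft_algebra m \<zeta>"
    unfolding taft_algebra_def by (rule ideal.quotient_is_ring[OF ideal_taft_ideal])
  have taft': "taft_module_lie_algebra scale' L' br' m \<zeta> ?act"
  proof unfold_locales
    fix f x y assume xy: "x \<in> L'" "y \<in> L'"
    show "?act (taft_class m \<zeta> f) (br' x y) =
        (\<Sum>(u, w)\<in>Poly_Mapping.keys (comult f). scale' (Poly_Mapping.lookup (comult f) (u, w))
          (br' (?act (taft_class m \<zeta> (Poly_Mapping.single u 1)) x)
              (?act (taft_class m \<zeta> (Poly_Mapping.single w 1)) y)))" (is "_ = ?rhs")
    proof (rule inj)
      show "?rhs \<in> L'" using xy by (intro sum') (auto simp: sc' br'_closed act)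
      have "\<psi> ?rhs = (\<Sum>p\<in>Poly_Mapping.keys (comult f). \<psi> (case p of (u, w) \<Rightarrow> scale' (Poly_Mapping.lookup (comult f) (u, w))
          (br' (?act (taft_class m \<zeta> (Poly_Mapping.single u 1)) x)
              (?act (taft_class m \<zeta> (Poly_Mapping.single w 1)) y))))"
        using xy by (intro sum') (auto simp: sc' br'_closed act)
      also have "\<dots> = (\<Sum>(u, w)\<in>Poly_Mapping.keys (comult f). scale (Poly_Mapping.lookup (comult f) (u, w))
          (br (act (taft_class m \<zeta> (Poly_Mapping.single u 1)) (\<psi> x))
              (act (taft_class m \<zeta> (Poly_Mapping.single w 1)) (\<psi> y))))"
        using xy by (intro sum.cong) (auto simp: sc br br'_closed act)
      also have "\<dots> = \<psi> (?act (taft_class m \<zeta> f) (br' x y))"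
        using xy by (simp add: act br br'_closed act_br[OF \<psi>L \<psi>L])
      finally show "\<psi> (?act (taft_class m \<zeta> f) (br' x y)) = \<psi> ?rhs" by simp
    qed (use xy in \<open>simp add: act br'_closed\<close>)
  next
    fix r x assume x: "x \<in> L'"
    then show "?act (taft_class m \<zeta> (free_scalar r)) x = scale' r x"
      by (intro inj) (simp_all add: act sc sc' \<psi>L act_scalar)
  next
    fix h k x assume hk: "h \<in> carrier (taft_algebra m \<zeta>)" "k \<in> carrier (taft_algebra m \<zeta>)"
      and x: "x \<in> L'"
    then show "?act (h \<oplus>\<^bsub>taft_algebra m \<zeta>\<^esub> k) x = ?act h x + ?act k x"
      by (intro inj) (simp_all add: act add add' \<psi>L act_add_left)
    from hk x show "?act (h \<otimes>\<^bsub>taft_algebra m \<zeta>\<^esub> k) x = ?act h (?act k x)"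
      by (intro inj) (simp_all add: act \<psi>L act_mult)
  next
    fix h x y assume h: "h \<in> carrier (taft_algebra m \<zeta>)" and xy: "x \<in> L'" "y \<in> L'"
    then show "?act h (x + y) = ?act h x + ?act h y"
      by (intro inj) (simp_all add: act add add' \<psi>L act_add_right)
  qed (use m_ge_2 primitive act in auto)
  \<comment> \<open>The isomorphism has to start from L, so \<open>\<psi>\<close> is
    inverted.\<close>
  define \<phi> where "\<phi> = the_inv_into L' \<psi>"
  have \<phi>: "\<phi> x \<in> L'" "\<psi> (\<phi> x) = x" if "x \<in> L" for x
    using bij that unfolding \<phi>_def bij_betw_def
    by (auto intro: the_inv_into_into f_the_inv_into_f)
  have "bij_betw \<phi> L L'" unfolding \<phi>_def by (rule bij_betw_the_inv_into[OF bij])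
  moreover have "\<phi> (x + y) = \<phi> x + \<phi> y" "\<phi> (br x y) = br' (\<phi> x) (\<phi> y)" if "x \<in> L" "y \<in> L" for x y
    using that \<phi> by (auto intro!: inj simp: add add' br br_closed br'_closed)
  moreover have "\<phi> (scale r x) = scale' r (\<phi> x)" if "x \<in> L" for r x
    using that \<phi> by (intro inj) (auto simp: sc sc')
  moreover have "\<phi> (act h x) = ?act h (\<phi> x)" if "h \<in> carrier (taft_algebra m \<zeta>)" "x \<in> L" for h x
    using that \<phi> by (intro inj) (auto simp: act act_closed)
  ultimately show ?thesis
    unfolding taft_lie_isomorphic_def using assms(1) taft' by blast
qed

section \<open>The map from m copies of B to L\<close>

context taft_semisimple
begin

text \<open>Positions 1 to m match exponents 0 to m - 1: entry i lands in
  \<open>orb (i - 1)\<close>, and the first one stays in \<open>B\<close>.\<close>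

definition unfold_copies :: "(nat \<Rightarrow> 'v) \<Rightarrow> 'v"
  where "unfold_copies a = (\<Sum>i\<in>{1..m}. (C ^^ (i - 1)) (a i))"

lemma B_L: "x \<in> B \<Longrightarrow> x \<in> L"
  using orb_L[of x 0] by (simp add: orb_0)

lemma copies_B: "a \<in> copies_carrier m B \<Longrightarrow> i \<in> {1..m} \<Longrightarrow> a i \<in> B"
  by (simp add: copies_carrier_def)

lemma lie_ideal_B: "lie_ideal B" and minimal_ideal_B: "minimal_ideal B"
  using lie_ideal_orb[of 0] minimal_ideal_orb[of 0] by (simp_all add: orb_0)

lemmas subspace_B = lie_idealD(1)[OF lie_ideal_B]

lemma cyclic_pred_mem: "i \<in> {1..m} \<Longrightarrow> cyclic_pred m i \<in> {1..m}"
  by (auto simp: cyclic_pred_def)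

lemma sum_cyclic_pred: "(\<Sum>i\<in>{1..m}. f (cyclic_pred m i)) = (\<Sum>i\<in>{1..m}. f i)"
proof (rule sum.reindex_bij_betw)
  show "bij_betw (cyclic_pred m) {1..m} {1..m}"
    using m_ge_2 by (intro bij_betw_byWitness[where f' = "\<lambda>i. if i = m then 1 else i + 1"])
      (auto simp: cyclic_pred_def)
qed

text \<open>For i = 1 the predecessor is m, and c^m = 1 closes the cycle.\<close>

lemma C_power_cyclic_pred:
  assumes "i \<in> {1..m}" "x \<in> L"
  shows "C ((C ^^ (cyclic_pred m i - 1)) x) = (C ^^ (i - 1)) x"
proof (cases "i = 1")
  case True
  have "Suc (m - 1) = m" using m_ge_2 by simp
  then show ?thesis
    using True C_power[OF assms(2)] funpow.simps(2)[of "m - 1" C]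
    by (simp add: cyclic_pred_def)
next
  case False
  then have "i - 1 = Suc (i - 1 - 1)" using assms(1) by auto
  then show ?thesis
    using False funpow.simps(2)[of "i - 1 - 1" C] by (simp add: cyclic_pred_def)
qed

lemma C_sum: "(\<And>i. i \<in> A \<Longrightarrow> f i \<in> L) \<Longrightarrow> C (\<Sum>i\<in>A. f i) = (\<Sum>i\<in>A. C (f i))"
  and V_sum: "(\<And>i. i \<in> A \<Longrightarrow> f i \<in> L) \<Longrightarrow> V (\<Sum>i\<in>A. f i) = (\<Sum>i\<in>A. V (f i))"
  by (induction A rule: infinite_finite_induct) (simp_all add: C_add V_add)

lemma unfold_copies_C:
  assumes a: "a \<in> copies_carrier m B"
  shows "unfold_copies (copies_c m a) = C (unfold_copies a)"
proof -
  have L: "a i \<in> L" if "i \<in> {1..m}" for i using copies_B[OF a that] B_L by blast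
  have "unfold_copies (copies_c m a) = (\<Sum>i\<in>{1..m}. (C ^^ (i - 1)) (a (cyclic_pred m i)))"
    unfolding unfold_copies_def by (intro sum.cong) (auto simp: copies_c_def)
  also have "\<dots> = (\<Sum>i\<in>{1..m}. C ((C ^^ (cyclic_pred m i - 1)) (a (cyclic_pred m i))))"
    by (intro sum.cong refl C_power_cyclic_pred[symmetric] L cyclic_pred_mem)
  also have "\<dots> = (\<Sum>i\<in>{1..m}. C ((C ^^ (i - 1)) (a i)))"
    by (rule sum_cyclic_pred[of "\<lambda>i. C ((C ^^ (i - 1)) (a i))"])
  also have "\<dots> = C (unfold_copies a)"
    unfolding unfold_copies_def by (rule C_sum[symmetric]) (intro Cn_closed L)
  finally show ?thesis .
qed

text \<open>With h i = c^(i-1) a_i, the element v(h i) has a part at position i and a part in c(h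
  i), at the next position. Collecting by position gives \<open>copies_v\<close>.\<close>

lemma unfold_copies_V:
  assumes V: "\<And>i d. d \<in> orb i \<Longrightarrow> V d = scale (\<alpha> * \<zeta> ^ i) d - scale (\<alpha> * \<zeta> ^ Suc i) (C d)"
    and a: "a \<in> copies_carrier m B"
  shows "unfold_copies (copies_v m \<zeta> scale \<alpha> a) = V (unfold_copies a)"
proof -
  have L: "a i \<in> L" if "i \<in> {1..m}" for i using copies_B[OF a that] B_L by blast
  \<comment> \<open>At i = 1 this is \<zeta>^m = 1.\<close>
  have \<zeta>: "\<zeta> ^ cyclic_pred m i = \<zeta> ^ (i - 1)" if "i \<in> {1..m}" for i
    using primitive by (auto simp: cyclic_pred_def primitive_root_of_unity_def)
  define h where "h i = (C ^^ (i - 1)) (a i)" for i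
  have hL: "h i \<in> L" if "i \<in> {1..m}" for i using L[OF that] by (simp add: h_def)
  have Cn_diff: "(C ^^ n) (scale r (x - y)) = scale r ((C ^^ n) x) - scale r ((C ^^ n) y)"
    if "x \<in> L" "y \<in> L" for n r x y
  proof -
    have "(C ^^ n) (x - y) = (C ^^ n) x - (C ^^ n) y"
      using that Cn_add[of "x - y" y n] by simp
    then show ?thesis
      unfolding Cn_scale[OF diff_in_L[OF that]] by (simp only: scale_right_diff_distrib)
  qed
  have "unfold_copies (copies_v m \<zeta> scale \<alpha> a) =
      (\<Sum>i\<in>{1..m}. scale (\<alpha> * \<zeta> ^ (i - 1)) (h i) - scale (\<alpha> * \<zeta> ^ cyclic_pred m i) (C (h (cyclic_pred m i))))"
    unfolding unfold_copies_def
  proof (rule sum.cong)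
    fix i assume i: "i \<in> {1..m}"
    note p = cyclic_pred_mem[OF i]
    have "copies_v m \<zeta> scale \<alpha> a i = scale (\<alpha> * \<zeta> ^ (i - 1)) (a i - a (cyclic_pred m i))"
      using i by (simp add: copies_v_def)
    then show "(C ^^ (i - 1)) (copies_v m \<zeta> scale \<alpha> a i) =
        scale (\<alpha> * \<zeta> ^ (i - 1)) (h i) - scale (\<alpha> * \<zeta> ^ cyclic_pred m i) (C (h (cyclic_pred m i)))"
      by (simp only: Cn_diff[OF L[OF i] L[OF p]] h_def C_power_cyclic_pred[OF i L[OF p]] \<zeta>[OF i])
  qed simp
  \<comment> \<open>Only the terms moved by c are reindexed cyclically.\<close>
  also have "\<dots> = (\<Sum>i\<in>{1..m}. scale (\<alpha> * \<zeta> ^ (i - 1)) (h i)) - (\<Sum>i\<in>{1..m}. scale (\<alpha> * \<zeta> ^ i) (C (h i)))"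
    by (simp only: sum_subtractf sum_cyclic_pred[of "\<lambda>i. scale (\<alpha> * \<zeta> ^ i) (C (h i))"])
  also have "\<dots> = (\<Sum>i\<in>{1..m}. V (h i))"
  proof -
    have "V (h i) = scale (\<alpha> * \<zeta> ^ (i - 1)) (h i) - scale (\<alpha> * \<zeta> ^ i) (C (h i))" if "i \<in> {1..m}" for i
    proof -
      have "h i \<in> orb (i - 1)" using copies_B[OF a that] by (simp add: h_def orb_def)
      moreover have "Suc (i - 1) = i" using that by simp
      ultimately show ?thesis using V[of "h i" "i - 1"] by metis
    qed
    then show ?thesis
      unfolding sum_subtractf[symmetric] by (intro sum.cong refl) (rule sym)
  qed
  also have "\<dots> = V (unfold_copies a)"
    unfolding unfold_copies_def h_def by (rule V_sum[symmetric]) (intro Cn_closed L)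
  finally show ?thesis .
qed

text \<open>Distinct orbit members commute, so bracketing with an element of
  \<open>orb (j - 1)\<close> isolates entry j. Both injectivity and compatibility with brackets rest
  on this.\<close>

lemma unfold_copies_br_orb:
  assumes "inj_on orb {..<m}" and a: "a \<in> copies_carrier m B"
    and j: "j \<in> {1..m}" and b: "b \<in> B"
  shows "br (unfold_copies a) ((C ^^ (j - 1)) b) = (C ^^ (j - 1)) (br (a j) b)"
proof -
  have L: "a i \<in> L" if "i \<in> {1..m}" for i using copies_B[OF a that] B_L by blast
  have bL: "b \<in> L" using b B_L by blast
  have "br (unfold_copies a) ((C ^^ (j - 1)) b) = (\<Sum>i\<in>{1..m}. br ((C ^^ (i - 1)) (a i)) ((C ^^ (j - 1)) b))"
    unfolding unfold_copies_def using L bL by (intro br_sum_left) simp_all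
  also have "\<dots> = (\<Sum>i\<in>{1..m}. if i = j then (C ^^ (j - 1)) (br (a j) b) else 0)"
  proof (rule sum.cong)
    fix i assume i: "i \<in> {1..m}"
    show "br ((C ^^ (i - 1)) (a i)) ((C ^^ (j - 1)) b) = (if i = j then (C ^^ (j - 1)) (br (a j) b) else 0)"
    proof (cases "i = j")
      case False
      then have "i - 1 \<noteq> j - 1" "i - 1 \<in> {..<m}" "j - 1 \<in> {..<m}" using i j by auto
      then have "orb (i - 1) \<noteq> orb (j - 1)" using assms(1) by (meson inj_onD)
      then show ?thesis
        using False br_orb[of "i - 1" "j - 1"] copies_B[OF a i] b by (simp add: orb_def)
    qed (use L[OF i] bL in \<open>simp add: Cn_br\<close>)
  qed simp
  also have "\<dots> = (C ^^ (j - 1)) (br (a j) b)" using j by simp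
  finally show ?thesis .
qed

lemma subspace_copies: "module.subspace (copies_scale scale) (copies_carrier m B)"
proof -
  interpret VC: vector_space "copies_scale scale"
    by (rule vector_space_copies_scale) (rule vector_space_axioms)
  show ?thesis
    by (intro VC.subspaceI) (auto simp: copies_carrier_def copies_scale_def subspace_0[OF subspace_B]
        subspace_add[OF subspace_B] subspace_scale[OF subspace_B])
qed

lemma unfold_copies_closed: "a \<in> copies_carrier m B \<Longrightarrow> unfold_copies a \<in> L"
  unfolding unfold_copies_def using copies_B B_L by (intro sum_in_L) simp

lemma unfold_copies_add:
  "a \<in> copies_carrier m B \<Longrightarrow> b \<in> copies_carrier m B \<Longrightarrow>
    unfold_copies (a + b) = unfold_copies a + unfold_copies b"
  unfolding unfold_copies_def using copies_B B_L by (simp add: Cn_add sum.distrib)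

lemma unfold_copies_scale:
  "a \<in> copies_carrier m B \<Longrightarrow> unfold_copies (copies_scale scale r a) = scale r (unfold_copies a)"
  unfolding unfold_copies_def using copies_B B_L by (simp add: copies_scale_def Cn_scale scale_sum_right)

lemma unfold_copies_single:
  assumes "x \<in> B" "i \<in> {1..m}"
  shows "(\<lambda>j. if j = i then x else 0) \<in> copies_carrier m B"
    "unfold_copies (\<lambda>j. if j = i then x else 0) = (C ^^ (i - 1)) x"
proof -
  show "(\<lambda>j. if j = i then x else 0) \<in> copies_carrier m B"
    using assms subspace_0[OF subspace_B] by (auto simp: copies_carrier_def)
  have "unfold_copies (\<lambda>j. if j = i then x else 0) = (\<Sum>j\<in>{1..m}. if j = i then (C ^^ (i - 1)) x else 0)"
    unfolding unfold_copies_def using Cn_eq_0_iff[of 0] by (intro sum.cong) auto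
  then show "unfold_copies (\<lambda>j. if j = i then x else 0) = (C ^^ (i - 1)) x"
    using assms by simp
qed

lemma orb_mod: "orb (i mod m) = orb i"
proof -
  have "orb (i + m * k) = orb i" for i k
  proof (induction k)
    case (Suc k)
    then show ?case using orb_m[of "i + m * k"] by (simp add: ac_simps)
  qed simp
  from this[of "i mod m" "i div m"] show ?thesis by simp
qed

text \<open>Orbit members other than \<open>B\<close> commute with x in any case, so x is central in
  L.\<close>

lemma B_separating:
  assumes "x \<in> B" "\<And>b. b \<in> B \<Longrightarrow> br x b = 0"
  shows "x = 0"
proof (rule orb_centralizer)
  show "x \<in> L" using assms B_L by blast
  show "br x y = 0" if y: "y \<in> orb i" for i y
  proof (cases "orb i = orb 0")
    case True
    then show ?thesis using assms(2) y by (simp add: orb_0)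
  next
    case False
    then show ?thesis using br_orb[of 0 i x y] assms(1) y by (simp add: orb_0)
  qed
qed

text \<open>Injectivity: brackets with c^(j-1) b recover all [a_j, b], and
  \<open>B_separating\<close> then determines a_j. Surjectivity: the image is a subspace containing
  every orbit member.\<close>

lemma bij_betw_unfold_copies:
  assumes "inj_on orb {..<m}"
  shows "bij_betw unfold_copies (copies_carrier m B) L"
  unfolding bij_betw_def
proof
  show "inj_on unfold_copies (copies_carrier m B)"
  proof (rule inj_onI)
    fix a a' assume a: "a \<in> copies_carrier m B" "a' \<in> copies_carrier m B"
      and eq: "unfold_copies a = unfold_copies a'"
    show "a = a'"
    proof
      fix j show "a j = a' j"
      proof (cases "j \<in> {1..m}")
        case True
        note aB = copies_B[OF a(1) True] copies_B[OF a(2) True]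
        have "br (a j - a' j) b = 0" if b: "b \<in> B" for b
        proof -
          have "(C ^^ (j - 1)) (br (a j) b) = (C ^^ (j - 1)) (br (a' j) b)"
            using unfold_copies_br_orb[OF assms a(1) True b] unfold_copies_br_orb[OF assms a(2) True b] eq
            by simp
          then have "br (a j) b = br (a' j) b"
            using Cn_inj aB b B_L br_closed by metis
          then show ?thesis using aB b B_L by (simp add: br_diff_left)
        qed
        then have "a j - a' j = 0"
          by (rule B_separating[OF subspace_diff[OF subspace_B aB]])
        then show ?thesis by simp
      next
        case False
        then show ?thesis using a by (simp add: copies_carrier_def)
      qed
    qed
  qed
  show "unfold_copies ` copies_carrier m B = L"
  proof
    show "unfold_copies ` copies_carrier m B \<subseteq> L" using unfold_copies_closed by blast
    interpret VC: vector_space "copies_scale scale"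
      by (rule vector_space_copies_scale) (rule vector_space_axioms)
    have "subspace (unfold_copies ` copies_carrier m B)"
    proof (rule subspaceI)
      show "0 \<in> unfold_copies ` copies_carrier m B"
        using unfold_copies_scale[OF VC.subspace_0[OF subspace_copies], of 0]
          VC.subspace_0[OF subspace_copies] by (auto simp: image_iff intro!: bexI[of _ 0])
    next
      fix x y assume "x \<in> unfold_copies ` copies_carrier m B" "y \<in> unfold_copies ` copies_carrier m B"
      then obtain a b where ab: "a \<in> copies_carrier m B" "b \<in> copies_carrier m B"
        "x = unfold_copies a" "y = unfold_copies b" by blast
      have "x + y = unfold_copies (a + b)"
        using unfold_copies_add[OF ab(1,2)] ab(3,4) by simp
      then show "x + y \<in> unfold_copies ` copies_carrier m B"
        using VC.subspace_add[OF subspace_copies ab(1,2)] by blast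
    next
      fix r x assume "x \<in> unfold_copies ` copies_carrier m B"
      then obtain a where a: "a \<in> copies_carrier m B" "x = unfold_copies a" by blast
      have "scale r x = unfold_copies (copies_scale scale r a)"
        using unfold_copies_scale[OF a(1)] a(2) by simp
      then show "scale r x \<in> unfold_copies ` copies_carrier m B"
        using VC.subspace_scale[OF subspace_copies a(1)] by blast
    qed
    moreover have "x \<in> unfold_copies ` copies_carrier m B" if x: "x \<in> orb i" for i x
    proof -
      have "x \<in> orb (i mod m)" using x by (simp add: orb_mod)
      then obtain b where b: "b \<in> B" "x = (C ^^ (i mod m)) b" by (auto simp: orb_def)
      \<comment> \<open>Exponent i mod m belongs to position i mod m + 1.\<close>
      have "i mod m + 1 \<in> {1..m}" using m_ge_2 by (simp add: Suc_le_eq)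
      note single = unfold_copies_single[OF b(1) this]
      have "x = unfold_copies (\<lambda>j. if j = i mod m + 1 then b else 0)"
        using single(2) b(2) by simp
      then show ?thesis using single(1) by (rule image_eqI)
    qed
    ultimately show "L \<subseteq> unfold_copies ` copies_carrier m B" using orb_span by blast
  qed
qed

lemma unfold_copies_br:
  assumes inj: "inj_on orb {..<m}" and a: "a \<in> copies_carrier m B" and b: "b \<in> copies_carrier m B"
  shows "unfold_copies (copies_br m br a b) = br (unfold_copies a) (unfold_copies b)"
proof -
  note aL = unfold_copies_closed[OF a]
  have L: "a i \<in> L" "b i \<in> L" if "i \<in> {1..m}" for i using copies_B[OF a that] copies_B[OF b that] B_L by blast+
  \<comment> \<open>The summands of b are expanded on the left, where \<open>br_sum_left\<close>
    applies; each then isolates one entry of a, up to sign.\<close>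
  have "br (\<Sum>i\<in>{1..m}. (C ^^ (i - 1)) (b i)) (unfold_copies a) =
      (\<Sum>i\<in>{1..m}. br ((C ^^ (i - 1)) (b i)) (unfold_copies a))"
    using aL L by (intro br_sum_left) simp_all
  also have "\<dots> = (\<Sum>i\<in>{1..m}. - (C ^^ (i - 1)) (br (a i) (b i)))"
  proof (rule sum.cong)
    fix i assume i: "i \<in> {1..m}"
    have "br ((C ^^ (i - 1)) (b i)) (unfold_copies a) = - br (unfold_copies a) ((C ^^ (i - 1)) (b i))"
      using aL L[OF i] by (intro br_anticomm) simp_all
    then show "br ((C ^^ (i - 1)) (b i)) (unfold_copies a) = - (C ^^ (i - 1)) (br (a i) (b i))"
      using unfold_copies_br_orb[OF inj a i copies_B[OF b i]] by simp
  qed simp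
  also have "\<dots> = - unfold_copies (copies_br m br a b)"
    by (simp add: unfold_copies_def copies_br_def sum_negf)
  finally have "br (unfold_copies b) (unfold_copies a) = - unfold_copies (copies_br m br a b)"
    by (simp add: unfold_copies_def)
  then show ?thesis using br_anticomm[OF aL unfold_copies_closed[OF b]] by simp
qed

lemma copies_isomorphic:
  assumes "V ` L \<noteq> {0}"
  shows "\<exists>\<alpha>. taft_lie_isomorphic m \<zeta> scale L br act
    (copies_scale scale) (copies_carrier m B) (copies_br m br) (copies_act m \<zeta> scale \<alpha>)"
proof -
  obtain \<alpha> where V: "\<And>i d. d \<in> orb i \<Longrightarrow> V d = scale (\<alpha> * \<zeta> ^ i) d - scale (\<alpha> * \<zeta> ^ Suc i) (C d)"
    using V_orb_explicit by blast
  have inj: "inj_on orb {..<m}" using orb_distinct[OF V assms] .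
  have "taft_lie_isomorphic m \<zeta> scale L br act (copies_scale scale) (copies_carrier m B) (copies_br m br)
      (taft_act (copies_scale scale) (copies_c m) (copies_v m \<zeta> scale \<alpha>))"
  proof (rule taft_lie_isomorphic_transport[OF taft_module_lie_algebra_axioms
        vector_space_copies_scale[OF vector_space_axioms] subspace_copies,
        where \<psi> = unfold_copies])
    fix x y assume xy: "x \<in> copies_carrier m B" "y \<in> copies_carrier m B"
    then show "copies_br m br x y \<in> copies_carrier m B"
      using lie_idealD(3)[OF lie_ideal_B] B_L by (auto simp: copies_carrier_def copies_br_def)
  next
    fix x assume x: "x \<in> copies_carrier m B"
    show "copies_c m x \<in> copies_carrier m B"
      using copies_B[OF x cyclic_pred_mem] by (auto simp: copies_carrier_def copies_c_def)
    show "copies_v m \<zeta> scale \<alpha> x \<in> copies_carrier m B"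
      using copies_B[OF x cyclic_pred_mem] copies_B[OF x]
      by (auto simp: copies_carrier_def copies_v_def intro!: subspace_scale[OF subspace_B] subspace_diff[OF subspace_B])
  qed (simp_all add: bij_betw_unfold_copies[OF inj] unfold_copies_add unfold_copies_scale
      unfold_copies_br[OF inj] unfold_copies_C unfold_copies_V[OF V])
  then show ?thesis unfolding copies_act_def by blast
qed

end

theorem theorem3p1:
  fixes scale :: "'f::{alg_closed_field, field_char_0} \<Rightarrow> 'v::ab_group_add \<Rightarrow> 'v"
    and L :: "'v set"
    and br :: "'v \<Rightarrow> 'v \<Rightarrow> 'v"
    and m :: nat
    and \<zeta> :: 'f
    and act :: "'f free_alg set \<Rightarrow> 'v \<Rightarrow> 'v"
  assumes "m \<ge> 2"
    and "primitive_root_of_unity m \<zeta>"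
    and "taft_module_lie_algebra scale L br m \<zeta> act"
    and "lie_algebra.fin_dim scale L"
    and "taft_module_lie_algebra.taft_simple scale L br m \<zeta> act"
    and "lie_algebra.semisimple scale L br"
    and "\<not> lie_algebra.simple scale L br"
  shows "taft_module_lie_algebra.graded_simple scale L br m \<zeta> act \<and>
    (act (taft_v m \<zeta>) ` L \<noteq> {0} \<longrightarrow>
      (\<exists>(B :: 'v set) brB \<alpha>.
        lie_algebra scale B brB \<and> lie_algebra.simple scale B brB \<and>
        taft_lie_isomorphic m \<zeta> scale L br act
          (copies_scale scale) (copies_carrier m B) (copies_br m brB) (copies_act m \<zeta> scale \<alpha>)))"
proof -
  interpret taft_semisimple scale L br m \<zeta> act
    by (intro taft_semisimple.intro taft_semisimple_axioms.intro assms(3-7))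
  \<comment> \<open>The simple Lie algebra is the minimal ideal \<open>B\<close> with the bracket of
    L.\<close>
  show ?thesis
    using graded_simple copies_isomorphic lie_algebra_lie_ideal[OF lie_ideal_B]
      simple_minimal_ideal[OF minimal_ideal_B] by blast
qed

end
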